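(* Let $X_t=\lim_{\varepsilon\to0}Y^\varepsilon_t$ be an indirect observability setup in $\mathbb{R}^r$ (see context), where $Y^\varepsilon_t$ approximates $X_t$ at uniform $L^4$-speed $\rho(\varepsilon)>0$, $\rho(\varepsilon)\to0$. Assume that $X_t$ has integrable decorrelation rate $f(T)$, and that $X_t$ is sparsely parametrized by $\boldsymbol\theta\in\Theta\subset\mathbb{R}^p$ (see context). Then there exist observable estimators $\hat{\boldsymbol\theta}^\varepsilon$ converging in probability to $\boldsymbol\theta$ as $\varepsilon\to0$. After selecting any sub-sampling scheme $N(\varepsilon),\Delta(\varepsilon)$ of the form $$N(\varepsilon)\sim\frac{1}{\rho(\varepsilon)^3},\qquad \Delta(\varepsilon)\sim\frac{1}{N(\varepsilon)^{1/3}}\sim\rho(\varepsilon),$$ one can construct these estimators by an expression of the form $$\hat{\boldsymbol\theta}^\varepsilon=G(\hat\Psi^\varepsilon)\quad\text{with}\quad \hat\Psi^\varepsilon=[\hat\Psi^\varepsilon_1,\dots,\hat\Psi^\varepsilon_p],$$ where $G:\mathbb{R}^p\to\mathbb{R}^p$ is a fixed smooth function and each $\hat\Psi^\varepsilon_j$ is the observable sub-sampled empirical estimator of the lagged moment $\Psi_j$ (of order $\le2$) of $X_t$. Moreover, if $\Theta$ is included in some known Euclidean ball $\Lambda$ of finite radius, the truncated observable estimators $1_\Lambda(\hat{\boldsymbol\theta}^\varepsilon)\,\hat{\boldsymbol\theta}^\varepsilon$ converge to $\boldsymbol\theta$ in $L^2$ norm as $\varepsilon\to0$, with $L^2$-speed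 of convergence at least as fast as $C\rho(\varepsilon)$ for some constant $C$, i.e. $\|1_\Lambda(\hat{\boldsymbol\theta}^\varepsilon)\hat{\boldsymbol\theta}^\varepsilon-\boldsymbol\theta\|_2\le C\rho(\varepsilon)$ for all sufficiently small $\varepsilon$.
   Context: Notation. For a matrix (or vector) $M=(M_{i,j})$, $\|M\|=\sup_{i,j}|M_{i,j}|$, and $M^*$ is its transpose. For a random matrix $M$, $\|M\|_p=\mathbb{E}(\|M\|^p)^{1/p}$. For functions $G,H$ of $\varepsilon$, $G\sim H$ means that $\lim_{\varepsilon\to0}G(\varepsilon)/H(\varepsilon)$ exists and is finite and strictly positive. Indirect observability setup. It consists of: observable continuous-time stochastic processes $Y^\varepsilon_t\in\mathbb{R}^r$ ($t\ge0$) indexed by a small parameter $\varepsilon>0$, with $\|Y^\varepsilon_t\|_4$ uniformly bounded over $\varepsilon>0$, $t\ge0$; and an (unobservable) strictly stationary process $X_t\in\mathbb{R}^r$ such that $\|Y^\varepsilon_t-X_t\|_4\le\rho(\varepsilon)$ for all $t\ge0$, $\varepsilon>0$, where $\rho(\varepsilon)\to0$ as $\varepsilon\to0$ ($\rho$ is called the uniform $L^4$-speed). The mean $\mu$ of $X_t$ and the lagged covariance matrices $K(u)=\mathbb{E}(X_tX_{t+u}^* )-\mu\mu^*$ are $C^1$ functions of an unknown parameter vector $\boldsymbol\theta\in\Theta$, $\Theta$ open in $\mathbb{R}^p$, and as functions of the lag $u$ the matrices $K(u)$ are locally Lipschitz, uniformly in $\boldsymbol\theta$. An observable estimator of $\boldsymbol\theta$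 is one that is, for each $\varepsilon$, a deterministic Borel function of finitely many observables $Y^\varepsilon_{t_1},\dots,Y^\varepsilon_{t_q}$, where $q$ and $t_1,\dots,t_q$ may depend on $\varepsilon$. Integrable decorrelation rate. Let $X_t$ be a stationary process in $\mathbb{R}^r$ with uniformly bounded moments of order 4 and coordinates $X_t(i)$. For a time interval $U\subset\mathbb{R}^+$, let $F_U$ be the set of all random variables of the form $X_s(i)$ or $X_s(i)X_t(j)$ with $s,t\in U$, $1\le i,j\le r$. Let $f(T)>0$ be a decreasing continuous function of $T>0$ with $\int_1^\infty f(T)\,dT<\infty$. Then $X_t$ has integrable decorrelation rate $f$ if for any disjoint time intervals $U,V$, with $U$ preceding $V$ and time gap $T=\inf_{u\in U,v\in V}(v-u)>0$, and any $G\in F_U$, $H\in F_V$, one has $|\mathbb{E}(GH)-\mathbb{E}(G)\mathbb{E}(H)|\le f(T)$. Sparse parametrization. A strictly stationary process $X_t$ is sparsely parametrized by $\boldsymbol\theta\in\mathbb{R}^p$ if there is a vector $\Psi=[\Psi_1,\dots,\Psi_p]$ of $p$ lagged moments of order $\le2$ of $X_t$ (each $\Psi_j$ being a coordinate of $\mu$ or an entry of some $K(u)$, $u\ge0$) which uniquely determines $\boldsymbol\theta$ as a smooth function $\boldsymbol\theta=G(\Psi)$ of $\Psi$. Sub-sampled estimators. A sub-sampling scheme consists of a time step $\Delta=\Delta(\varepsilon)>0$ and a number of observations $N=N(\varepsilon)\in\mathbb{N}$. For a lag $u\ge0$, $\kappa=\kappa(u,\varepsilon)$ is the closest integer to $u/\Delta(\varepsilon)$.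 Define $$\bar Y^\varepsilon=\frac1N\sum_{n=1}^NY^\varepsilon_{n\Delta},\quad \tau_u\bar Y^\varepsilon=\frac1N\sum_{n=1}^NY^\varepsilon_{(n+\kappa)\Delta},\quad \hat K^\varepsilon_Y(u)=\frac1N\sum_{n=1}^NY^\varepsilon_{n\Delta}(Y^\varepsilon_{(n+\kappa)\Delta})^*-\bar Y^\varepsilon(\tau_u\bar Y^\varepsilon)^*.$$ The observable sub-sampled empirical estimator $\hat\Psi^\varepsilon_j$ of $\Psi_j$ is the corresponding coordinate of $\bar Y^\varepsilon$ (if $\Psi_j$ is a coordinate of $\mu$) or the corresponding entry of $\hat K^\varepsilon_Y(u)$ (if $\Psi_j$ is an entry of $K(u)$). *)

theory Defs
  imports "HOL-Probability.Probability"
begin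

text \<open>
  Vectors and matrices are measured by their largest absolute entry throughout; on \<open>real ^ 'n\<close>
  this is the library's \<^const>\<open>infnorm\<close>. The distribution parameter \<open>\<theta>\<close> indexes a family of
  probability spaces \<open>M \<theta>\<close>, and the processes may depend on it as well.
\<close>

definition Lp_norm :: "'a measure \<Rightarrow> nat \<Rightarrow> ('a \<Rightarrow> real ^ 'n) \<Rightarrow> real" where
  "Lp_norm M p Z = (LINT \<omega>|M. infnorm (Z \<omega>) ^ p) powr (1 / real p)"

text \<open>The Bochner integral of a non-integrable function is 0, so a bound needs integrability.\<close>

definition Lp_norm_le :: "'a measure \<Rightarrow> nat \<Rightarrow> ('a \<Rightarrow> real ^ 'n) \<Rightarrow> real \<Rightarrow> bool" where
  "Lp_norm_le M p Z c \<longleftrightarrow> integrable M (\<lambda>\<omega>. infnorm (Z \<omega>) ^ p) \<and> Lp_norm M p Z \<le> c"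

definition same_order :: "(real \<Rightarrow> real) \<Rightarrow> (real \<Rightarrow> real) \<Rightarrow> bool" where
  "same_order G H \<longleftrightarrow> (\<exists>c>0. ((\<lambda>\<epsilon>. G \<epsilon> / H \<epsilon>) \<longlongrightarrow> c) (at_right 0))"

text \<open>\<open>C_on k f S\<close>: \<open>f\<close> is of class \<open>C\<^sup>k\<close> on the open set \<open>S\<close> of a finite-dimensional space.\<close>

primrec C_on :: "nat \<Rightarrow> ('v::euclidean_space \<Rightarrow> 'w::real_normed_vector) \<Rightarrow> 'v set \<Rightarrow> bool" where
  "C_on 0 f S \<longleftrightarrow> continuous_on S f"
| "C_on (Suc k) f S \<longleftrightarrow> (\<forall>x\<in>S. f differentiable (at x)) \<and>
     (\<forall>v. C_on k (\<lambda>x. frechet_derivative f (at x) v) S)"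

definition smooth :: "('v::euclidean_space \<Rightarrow> 'w::real_normed_vector) \<Rightarrow> bool" where
  "smooth f \<longleftrightarrow> (\<forall>k. C_on k f UNIV)"

definition outer :: "real ^ 'r \<Rightarrow> real ^ 'r \<Rightarrow> real ^ 'r ^ 'r" where
  "outer x y = (\<chi> i j. x $ i * y $ j)"

subsection \<open>Stationary processes and their moments of order at most 2\<close>

definition strictly_stationary :: "'a measure \<Rightarrow> (real \<Rightarrow> 'a \<Rightarrow> real ^ 'r) \<Rightarrow> bool" where
  "strictly_stationary M X \<longleftrightarrow> (\<forall>t\<ge>0. X t \<in> borel_measurable M) \<and>
     (\<forall>J h. finite J \<and> J \<subseteq> {0..} \<and> 0 \<le> h \<longrightarrow>
        distr M (PiM J (\<lambda>_. borel)) (\<lambda>\<omega>. \<lambda>t\<in>J. X (t + h) \<omega>) =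
        distr M (PiM J (\<lambda>_. borel)) (\<lambda>\<omega>. \<lambda>t\<in>J. X t \<omega>))"

text \<open>For stationary processes the base time \<open>0\<close> below can be replaced by any other time.\<close>

definition proc_mean :: "'a measure \<Rightarrow> (real \<Rightarrow> 'a \<Rightarrow> real ^ 'r) \<Rightarrow> real ^ 'r" where
  "proc_mean M X = (LINT \<omega>|M. X 0 \<omega>)"

definition lagged_cov :: "'a measure \<Rightarrow> (real \<Rightarrow> 'a \<Rightarrow> real ^ 'r) \<Rightarrow> real \<Rightarrow> real ^ 'r ^ 'r" where
  "lagged_cov M X u = (LINT \<omega>|M. outer (X 0 \<omega>) (X u \<omega>)) - outer (proc_mean M X) (proc_mean M X)"

definition low_order_products :: "(real \<Rightarrow> 'a \<Rightarrow> real ^ 'r) \<Rightarrow> real set \<Rightarrow> ('a \<Rightarrow> real) set" where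
  "low_order_products X U =
     {(\<lambda>\<omega>. X s \<omega> $ i) | s i. s \<in> U} \<union> {(\<lambda>\<omega>. X s \<omega> $ i * X t \<omega> $ j) | s t i j. s \<in> U \<and> t \<in> U}"

definition integrable_decorrelation_rate ::
    "'a measure \<Rightarrow> (real \<Rightarrow> 'a \<Rightarrow> real ^ 'r) \<Rightarrow> (real \<Rightarrow> real) \<Rightarrow> bool" where
  "integrable_decorrelation_rate M X f \<longleftrightarrow>
     (\<exists>B. \<forall>t\<ge>0. Lp_norm_le M 4 (X t) B) \<and>
     (\<forall>T>0. 0 < f T) \<and> antimono_on {0<..} f \<and> continuous_on {0<..} f \<and>
     set_integrable lborel {1..} f \<and>
     (\<forall>U V T. is_interval U \<and> is_interval V \<and> U \<noteq> {} \<and> V \<noteq> {} \<and> U \<subseteq> {0..} \<and> V \<subseteq> {0..} \<and>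
        (\<forall>u\<in>U. \<forall>v\<in>V. u < v) \<and> T = (INF (u, v)\<in>U \<times> V. v - u) \<and> 0 < T \<longrightarrow>
        (\<forall>G\<in>low_order_products X U. \<forall>H\<in>low_order_products X V.
           \<bar>(LINT \<omega>|M. G \<omega> * H \<omega>) - (LINT \<omega>|M. G \<omega>) * (LINT \<omega>|M. H \<omega>)\<bar> \<le> f T))"

text \<open>\<open>Mean i\<close> stands for the \<open>i\<close>-th coordinate of the mean, \<open>Cov i j u\<close> for the entry \<open>(i, j)\<close>
  of the covariance matrix with lag \<open>u\<close>.\<close>

datatype 'r lagged_moment = Mean 'r | Cov 'r 'r real

primrec valid_lag :: "'r lagged_moment \<Rightarrow> bool" where
  "valid_lag (Mean i) \<longleftrightarrow> True"
| "valid_lag (Cov i j u) \<longleftrightarrow> 0 \<le> u"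

primrec moment_value ::
    "'a measure \<Rightarrow> (real \<Rightarrow> 'a \<Rightarrow> real ^ 'r) \<Rightarrow> 'r lagged_moment \<Rightarrow> real" where
  "moment_value M X (Mean i) = proc_mean M X $ i"
| "moment_value M X (Cov i j u) = lagged_cov M X u $ i $ j"

definition sparse_parametrization ::
    "(real ^ 'p) set \<Rightarrow> (real ^ 'p \<Rightarrow> 'a measure) \<Rightarrow> (real ^ 'p \<Rightarrow> real \<Rightarrow> 'a \<Rightarrow> real ^ 'r) \<Rightarrow>
     ('p \<Rightarrow> 'r lagged_moment) \<Rightarrow> (real ^ 'p \<Rightarrow> real ^ 'p) \<Rightarrow> bool" where
  "sparse_parametrization \<Theta> M X \<Psi> G \<longleftrightarrow>
     (\<forall>j. valid_lag (\<Psi> j)) \<and> smooth G \<and>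
     (\<forall>\<theta>\<in>\<Theta>. \<theta> = G (\<chi> j. moment_value (M \<theta>) (X \<theta>) (\<Psi> j)))"

subsection \<open>Indirect observability\<close>

locale indirect_observability =
  fixes \<Theta> :: "(real ^ 'p) set"
    and M :: "real ^ 'p \<Rightarrow> 'a measure"
    and X :: "real ^ 'p \<Rightarrow> real \<Rightarrow> 'a \<Rightarrow> real ^ 'r"
    and Y :: "real ^ 'p \<Rightarrow> real \<Rightarrow> real \<Rightarrow> 'a \<Rightarrow> real ^ 'r"
    and \<rho> :: "real \<Rightarrow> real"
  assumes open_params: "open \<Theta>"
    and prob_space_M: "\<theta> \<in> \<Theta> \<Longrightarrow> prob_space (M \<theta>)"
    and Y_measurable: "\<theta> \<in> \<Theta> \<Longrightarrow> 0 < \<epsilon> \<Longrightarrow> 0 \<le> t \<Longrightarrow> Y \<theta> \<epsilon> t \<in> borel_measurable (M \<theta>)"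
    and Y_bounded: "\<theta> \<in> \<Theta> \<Longrightarrow> \<exists>B. \<forall>\<epsilon>>0. \<forall>t\<ge>0. Lp_norm_le (M \<theta>) 4 (Y \<theta> \<epsilon> t) B"
    and X_stationary: "\<theta> \<in> \<Theta> \<Longrightarrow> strictly_stationary (M \<theta>) (X \<theta>)"
    and rho_pos: "0 < \<epsilon> \<Longrightarrow> 0 < \<rho> \<epsilon>"
    and rho_tendsto: "(\<rho> \<longlongrightarrow> 0) (at_right 0)"
    and Y_approx: "\<theta> \<in> \<Theta> \<Longrightarrow> 0 < \<epsilon> \<Longrightarrow> 0 \<le> t \<Longrightarrow>
      Lp_norm_le (M \<theta>) 4 (\<lambda>\<omega>. Y \<theta> \<epsilon> t \<omega> - X \<theta> t \<omega>) (\<rho> \<epsilon>)"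
    and mean_C1: "C_on 1 (\<lambda>\<theta>. proc_mean (M \<theta>) (X \<theta>)) \<Theta>"
    and cov_C1: "0 \<le> u \<Longrightarrow> C_on 1 (\<lambda>\<theta>. lagged_cov (M \<theta>) (X \<theta>) u) \<Theta>"
    and cov_Lipschitz: "0 \<le> u \<Longrightarrow> \<exists>\<delta>>0. \<exists>L. \<forall>\<theta>\<in>\<Theta>.
      L-lipschitz_on (cball u \<delta> \<inter> {0..}) (lagged_cov (M \<theta>) (X \<theta>))"

text \<open>
  An estimator is given by its realisations \<open>est \<theta> \<epsilon> \<omega>\<close>, \<open>\<theta>\<close> being the true parameter. It is
  observable if the Borel function \<open>g\<close> and the observation times can be chosen independently of \<open>\<theta>\<close>.
\<close>

definition observable_estimator ::
    "(real ^ 'p) set \<Rightarrow> (real ^ 'p \<Rightarrow> 'a measure) \<Rightarrow> (real ^ 'p \<Rightarrow> real \<Rightarrow> real \<Rightarrow> 'a \<Rightarrow> real ^ 'r) \<Rightarrow>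
     (real ^ 'p \<Rightarrow> real \<Rightarrow> 'a \<Rightarrow> real ^ 'p) \<Rightarrow> bool" where
  "observable_estimator \<Theta> M Y est \<longleftrightarrow>
     (\<forall>\<epsilon>>0. \<exists>(q::nat) (t :: nat \<Rightarrow> real) g.
        (\<forall>i<q. 0 \<le> t i) \<and> g \<in> borel_measurable (PiM {..<q} (\<lambda>_. borel)) \<and>
        (\<forall>\<theta>\<in>\<Theta>. \<forall>\<omega>\<in>space (M \<theta>). est \<theta> \<epsilon> \<omega> = g (\<lambda>i\<in>{..<q}. Y \<theta> \<epsilon> (t i) \<omega>)))"

definition consistent ::
    "(real ^ 'p) set \<Rightarrow> (real ^ 'p \<Rightarrow> 'a measure) \<Rightarrow> (real ^ 'p \<Rightarrow> real \<Rightarrow> 'a \<Rightarrow> real ^ 'p) \<Rightarrow> bool" where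
  "consistent \<Theta> M est \<longleftrightarrow> (\<forall>\<theta>\<in>\<Theta>. \<forall>\<delta>>0.
     ((\<lambda>\<epsilon>. measure (M \<theta>) {\<omega> \<in> space (M \<theta>). \<delta> < infnorm (est \<theta> \<epsilon> \<omega> - \<theta>)}) \<longlongrightarrow> 0) (at_right 0))"

subsection \<open>Sub-sampled empirical estimators\<close>

definition subsampling_scheme ::
    "(real \<Rightarrow> real) \<Rightarrow> (real \<Rightarrow> nat) \<Rightarrow> (real \<Rightarrow> real) \<Rightarrow> bool" where
  "subsampling_scheme \<rho> N \<Delta> \<longleftrightarrow>
     (\<forall>\<epsilon>>0. 0 < N \<epsilon> \<and> 0 < \<Delta> \<epsilon>) \<and>
     same_order (\<lambda>\<epsilon>. real (N \<epsilon>)) (\<lambda>\<epsilon>. 1 / \<rho> \<epsilon> ^ 3) \<and>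
     same_order \<Delta> (\<lambda>\<epsilon>. 1 / real (N \<epsilon>) powr (1 / 3)) \<and>
     same_order (\<lambda>\<epsilon>. 1 / real (N \<epsilon>) powr (1 / 3)) \<rho>"

text \<open>In the following, \<open>y\<close> is a path \<open>t \<mapsto> Y\<^sub>t(\<omega>)\<close>, \<open>N\<close> the number of observations, \<open>\<Delta>\<close> the time
  step and \<open>k\<close> a shift counted in time steps.\<close>

definition emp_mean :: "nat \<Rightarrow> real \<Rightarrow> nat \<Rightarrow> (real \<Rightarrow> real ^ 'r) \<Rightarrow> real ^ 'r" where
  "emp_mean N \<Delta> k y = (1 / real N) *\<^sub>R (\<Sum>n=1..N. y (real (n + k) * \<Delta>))"

definition lag_steps :: "real \<Rightarrow> real \<Rightarrow> nat" where
  "lag_steps \<Delta> u = nat (round (u / \<Delta>))"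

definition emp_cov :: "nat \<Rightarrow> real \<Rightarrow> real \<Rightarrow> (real \<Rightarrow> real ^ 'r) \<Rightarrow> real ^ 'r ^ 'r" where
  "emp_cov N \<Delta> u y =
     (let k = lag_steps \<Delta> u in
       (1 / real N) *\<^sub>R (\<Sum>n=1..N. outer (y (real n * \<Delta>)) (y (real (n + k) * \<Delta>)))
       - outer (emp_mean N \<Delta> 0 y) (emp_mean N \<Delta> k y))"

primrec emp_moment ::
    "nat \<Rightarrow> real \<Rightarrow> (real \<Rightarrow> real ^ 'r) \<Rightarrow> 'r lagged_moment \<Rightarrow> real" where
  "emp_moment N \<Delta> y (Mean i) = emp_mean N \<Delta> 0 y $ i"
| "emp_moment N \<Delta> y (Cov i j u) = emp_cov N \<Delta> u y $ i $ j"

definition moment_estimator ::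
    "(real ^ 'p \<Rightarrow> real \<Rightarrow> real \<Rightarrow> 'a \<Rightarrow> real ^ 'r) \<Rightarrow> ('p \<Rightarrow> 'r lagged_moment) \<Rightarrow>
     (real ^ 'p \<Rightarrow> real ^ 'p) \<Rightarrow> (real \<Rightarrow> nat) \<Rightarrow> (real \<Rightarrow> real) \<Rightarrow>
     real ^ 'p \<Rightarrow> real \<Rightarrow> 'a \<Rightarrow> real ^ 'p" where
  "moment_estimator Y \<Psi> G N \<Delta> \<theta> \<epsilon> \<omega> =
     G (\<chi> j. emp_moment (N \<epsilon>) (\<Delta> \<epsilon>) (\<lambda>t. Y \<theta> \<epsilon> t \<omega>) (\<Psi> j))"

definition truncated ::
    "'v::real_vector set \<Rightarrow> ('t \<Rightarrow> real \<Rightarrow> 'a \<Rightarrow> 'v) \<Rightarrow> 't \<Rightarrow> real \<Rightarrow> 'a \<Rightarrow> 'v" where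
  "truncated \<Lambda> est \<theta> \<epsilon> \<omega> = indicator \<Lambda> (est \<theta> \<epsilon> \<omega>) *\<^sub>R est \<theta> \<epsilon> \<omega>"

end

theory Submission
  imports Defs
begin

text \<open>
  Write \<open>D\<close> for the error of an empirical moment. Replacing \<open>Y\<close> by \<open>X\<close> costs \<open>O(\<rho>)\<close> in \<open>L\<^sup>2\<close>, by
  Cauchy-Schwarz and the fourth moments. Summing the decorrelation rate over the sampling grid
  compares with \<open>\<integral> f\<close>, so averages over \<open>X\<close> have variance \<open>O(1 / (N \<Delta>)) = O(\<rho>\<^sup>2)\<close>, and rounding the lag
  biases the covariance by \<open>O(\<Delta>) = O(\<rho>)\<close>. Hence \<open>E (min 1 D\<^sup>2) = O(\<rho>\<^sup>2)\<close>, which is all that is needed: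
  \<open>G\<close> is Lipschitz near the true moments, \<open>\<theta>\<close> is interior to \<open>\<Lambda>\<close>, and the truncated
  estimator is bounded.
\<close>

subsection \<open>Moment bounds\<close>

text \<open>The exponents of the scheme balance three errors: approximation \<rho>, lag rounding
  \<Delta>, and the standard deviation (N \<Delta>)^(-1/2) of an average over the grid. For N of
  order \<rho>^(-3) and \<Delta> of order \<rho> all three have order \<rho>. What counts in the
  variance is the observed time span N \<Delta>, not N itself: each observation has about 1/\<Delta>
  neighbours with which it may be strongly correlated. The rate \<open>f\<close> is integrable only
  on [1, infinity) and may blow up at 0, so pairs of observations whose windows are less than about
  one time unit apart are bounded by moments alone and only the remaining pairs by \<open>f\<close>.
  Nothing is known about the growth of \<open>G\<close>, so \<open>G\<close> of the empirical
  moments need not be square integrable. Without truncation only convergence in probability is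
  claimed; it follows from the same bound on E (min 1 D^2) by Markov's inequality. That \<theta> is
  interior to \<Lambda> comes from \<Theta> being open and contained in \<Lambda>. All constants may
  depend on \<theta>.\<close>

text \<open>Used with k = 2 and k = 4, where it bounds the L^k norm by \<open>c\<close>; comparing
  k-th powers avoids taking roots. Integrability is part of the notion because the integral of a
  non-integrable function is 0.\<close>

definition moment_le :: "'a measure \<Rightarrow> nat \<Rightarrow> ('a \<Rightarrow> real) \<Rightarrow> real \<Rightarrow> bool" where
  "moment_le M k Z c \<longleftrightarrow> Z \<in> borel_measurable M \<and> integrable M (\<lambda>\<omega>. Z \<omega> ^ k) \<and>
     (LINT \<omega>|M. Z \<omega> ^ k) \<le> c ^ k"

lemma moment_leD:
  assumes "moment_le M k Z c"
  shows "Z \<in> borel_measurable M" "integrable M (\<lambda>\<omega>. Z \<omega> ^ k)" "(LINT \<omega>|M. Z \<omega> ^ k) \<le> c ^ k"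
  using assms by (auto simp: moment_le_def)

lemma moment_le_bounded_by:
  assumes "Z \<in> borel_measurable M" "integrable M W" "even k"
    and "\<And>\<omega>. Z \<omega> ^ k \<le> W \<omega>" and "(LINT \<omega>|M. W \<omega>) \<le> c ^ k"
  shows "moment_le M k Z c"
proof -
  note [measurable] = assms(1)
  have "integrable M (\<lambda>\<omega>. Z \<omega> ^ k)"
    using assms by (intro Bochner_Integration.integrable_bound[OF assms(2)])
      (auto simp: zero_le_even_power intro!: order_trans[OF _ abs_ge_self])
  moreover from this have "(LINT \<omega>|M. Z \<omega> ^ k) \<le> (LINT \<omega>|M. W \<omega>)"
    using assms by (intro integral_mono) auto
  ultimately show ?thesis using assms by (auto simp: moment_le_def)
qed

section \<open>Coordinatewise measurability and integration of vectors and matrices\<close>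

lemma borel_measurable_vec_nth [measurable]:
  fixes Z :: "'a \<Rightarrow> 'b::real_normed_vector ^ 'n"
  assumes "Z \<in> borel_measurable M"
  shows "(\<lambda>\<omega>. Z \<omega> $ i) \<in> borel_measurable M"
  using assms by (rule borel_measurable_continuous_on[rotated]) (intro continuous_intros)

lemma borel_measurable_vec_lambda:
  fixes Z :: "'n::finite \<Rightarrow> 'a \<Rightarrow> real"
  assumes "\<And>i. Z i \<in> borel_measurable M"
  shows "(\<lambda>\<omega>. \<chi> i. Z i \<omega>) \<in> borel_measurable M"
proof (rule borel_measurable_euclidean_space[THEN iffD2], rule ballI)
  fix b :: "real ^ 'n" assume "b \<in> Basis"
  then obtain i where "b = axis i 1" by (auto simp: Basis_vec_def)
  then show "(\<lambda>\<omega>. (\<chi> i. Z i \<omega>) \<bullet> b) \<in> borel_measurable M"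
    using assms by (simp add: inner_axis)
qed

text \<open>The entries lie in a general Euclidean space so that the rule can be applied twice to a
  matrix, first to its rows and then to their entries.\<close>

lemma integrable_vec:
  fixes Z :: "'a \<Rightarrow> 'b::euclidean_space ^ 'n"
  assumes "\<And>i. integrable M (\<lambda>\<omega>. Z \<omega> $ i)"
  shows "integrable M Z"
proof -
  have bl: "bounded_linear (axis i :: 'b \<Rightarrow> 'b ^ 'n)" for i
    by (intro bounded_linear_intro[where K=1])
      (auto simp: vec_eq_iff axis_def[of _ "_ + _"] axis_def[of _ "_ *\<^sub>R _"] norm_eq_sqrt_inner inner_axis_axis,
        auto simp: axis_def)
  have "integrable M (\<lambda>\<omega>. \<Sum>i\<in>UNIV. axis i (Z \<omega> $ i))"
    by (intro Bochner_Integration.integrable_sum integrable_bounded_linear[OF bl] assms)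
  moreover have "(\<lambda>\<omega>. \<Sum>i\<in>UNIV. axis i (Z \<omega> $ i)) = Z"
    by (auto simp: fun_eq_iff vec_eq_iff axis_def if_distrib cong: if_cong)
  ultimately show ?thesis by simp
qed

lemma integral_vec_nth:
  fixes Z :: "'a \<Rightarrow> 'b::euclidean_space ^ 'n"
  assumes "integrable M Z"
  shows "(LINT \<omega>|M. Z \<omega>) $ i = (LINT \<omega>|M. Z \<omega> $ i)"
  using integral_bounded_linear[OF bounded_linear_vec_nth assms, of i] by simp

section \<open>Inequalities between second and fourth moments\<close>

lemma Lp_norm_le_component:
  assumes "Z \<in> borel_measurable M" and "Lp_norm_le M k Z c" and "even k" "0 < k"
  shows "moment_le M k (\<lambda>\<omega>. Z \<omega> $ i) c"
proof -
  let ?E = "LINT \<omega>|M. infnorm (Z \<omega>) ^ k"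
  have int: "integrable M (\<lambda>\<omega>. infnorm (Z \<omega>) ^ k)" and le: "?E powr (1 / real k) \<le> c"
    using assms by (auto simp: Lp_norm_le_def Lp_norm_def)
  have E0: "?E \<ge> 0" by (intro Bochner_Integration.integral_nonneg) (auto simp: infnorm_pos_le)
  have "?E = (?E powr (1 / real k)) ^ k"
    using E0 assms by (cases "?E = 0") (auto simp: powr_powr simp flip: powr_realpow)
  also have "\<dots> \<le> c ^ k" using le by (intro power_mono) auto
  finally have E: "?E \<le> c ^ k" .
  have [measurable]: "Z \<in> borel_measurable M" by fact
  show ?thesis
  proof (rule moment_le_bounded_by[OF _ int assms(3) _ E])
    show "(Z \<omega> $ i) ^ k \<le> infnorm (Z \<omega>) ^ k" for \<omega>
      using power_mono[OF component_le_infnorm_cart[of "Z \<omega>" i], of k] assms(3)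
      by (simp add: power_even_abs)
  qed measurable
qed

text \<open>Cauchy-Schwarz, obtained from a weighted arithmetic-geometric mean inequality; the
  weights require \<open>a\<close> and \<open>b\<close> to be positive.\<close>

lemma moment_le_mult:
  assumes U: "moment_le M 4 U a" and V: "moment_le M 4 V b" and "0 < a" "0 < b"
  shows "moment_le M 2 (\<lambda>\<omega>. U \<omega> * V \<omega>) (a * b)"
proof -
  note [measurable] = moment_leD(1)[OF U] moment_leD(1)[OF V]
  \<comment> \<open>This is half the sum of squares of (b/a) U^2 and (a/b) V^2, whose product is (U
    V)^2. The weights make both terms contribute at most a^2 b^2 / 2 in expectation.\<close>
  let ?W = "\<lambda>\<omega>. (b\<^sup>2 / (2 * a\<^sup>2)) * U \<omega> ^ 4 + (a\<^sup>2 / (2 * b\<^sup>2)) * V \<omega> ^ 4"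
  show ?thesis
  proof (rule moment_le_bounded_by[where W = ?W])
    show "integrable M ?W" using U V by (auto simp: moment_le_def)
    have "(LINT \<omega>|M. ?W \<omega>) = (b\<^sup>2 / (2 * a\<^sup>2)) * (LINT \<omega>|M. U \<omega> ^ 4) + (a\<^sup>2 / (2 * b\<^sup>2)) * (LINT \<omega>|M. V \<omega> ^ 4)"
      using U V by (simp add: moment_le_def)
    also have "\<dots> \<le> (b\<^sup>2 / (2 * a\<^sup>2)) * a ^ 4 + (a\<^sup>2 / (2 * b\<^sup>2)) * b ^ 4"
      using U V by (intro add_mono mult_left_mono) (auto simp: moment_le_def)
    also have "\<dots> = (a * b)\<^sup>2"
      using assms by (simp add: field_simps power2_eq_square power4_eq_xxxx)
    finally show "(LINT \<omega>|M. ?W \<omega>) \<le> (a * b)\<^sup>2" .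
    fix \<omega>
    have "0 \<le> ((b / a) * U \<omega> ^ 2 - (a / b) * V \<omega> ^ 2)\<^sup>2" by simp
    also have "\<dots> = 2 * (?W \<omega> - (U \<omega> * V \<omega>)\<^sup>2)"
      using assms by (simp add: field_simps power2_eq_square power4_eq_xxxx)
    finally show "(U \<omega> * V \<omega>)\<^sup>2 \<le> ?W \<omega>" by simp
  qed auto
qed

lemma (in prob_space) moment_le_4_2:
  assumes "moment_le M 4 U a" "0 < a"
  shows "moment_le M 2 U a"
  using moment_le_mult[of M U a "\<lambda>_. 1" 1] assms by (simp add: moment_le_def prob_space)

text \<open>Minkowski's inequality by convexity: U + V is the mean of ((a+b)/a) U and ((a+b)/b) V
  with weights a/(a+b) and b/(a+b). The gap in the resulting inequality is (b U - a V)^2 / (a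
  b).\<close>

lemma moment_le_add:
  assumes U: "moment_le M 2 U a" and V: "moment_le M 2 V b" and ab: "0 < a" "0 < b"
  shows "moment_le M 2 (\<lambda>\<omega>. U \<omega> + V \<omega>) (a + b)"
proof -
  note [measurable] = moment_leD(1)[OF U] moment_leD(1)[OF V]
  let ?W = "\<lambda>\<omega>. ((a + b) / a) * (U \<omega>)\<^sup>2 + ((a + b) / b) * (V \<omega>)\<^sup>2"
  show ?thesis
  proof (rule moment_le_bounded_by[where W = ?W])
    show "integrable M ?W" using U V by (auto simp: moment_le_def)
    have "(LINT \<omega>|M. ?W \<omega>) = ((a + b) / a) * (LINT \<omega>|M. (U \<omega>)\<^sup>2) + ((a + b) / b) * (LINT \<omega>|M. (V \<omega>)\<^sup>2)"
      using U V by (simp add: moment_le_def)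
    also have "\<dots> \<le> ((a + b) / a) * a\<^sup>2 + ((a + b) / b) * b\<^sup>2"
      using U V ab by (intro add_mono mult_left_mono) (auto simp: moment_le_def)
    also have "\<dots> = (a + b)\<^sup>2"
      using ab by (simp add: field_simps power2_eq_square)
    finally show "(LINT \<omega>|M. ?W \<omega>) \<le> (a + b)\<^sup>2" .
    fix \<omega>
    have "0 \<le> (b * U \<omega> - a * V \<omega>)\<^sup>2 / (a * b)" using ab by simp
    also have "\<dots> = ?W \<omega> - (U \<omega> + V \<omega>)\<^sup>2"
      using ab by (simp add: field_simps power2_eq_square)
    finally show "(U \<omega> + V \<omega>)\<^sup>2 \<le> ?W \<omega>" by simp
  qed auto
qed

lemma moment_le_cmult:
  assumes "moment_le M 2 U a"
  shows "moment_le M 2 (\<lambda>\<omega>. d * U \<omega>) (\<bar>d\<bar> * a)"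
  using assms by (auto simp: moment_le_def power_mult_distrib intro!: mult_left_mono)

lemma moment_le_mono:
  assumes "moment_le M 2 U a" "0 \<le> a" "a \<le> b"
  shows "moment_le M 2 U b"
  unfolding moment_le_def
  using moment_leD[OF assms(1)] power_mono[OF assms(3,2), of 2] by (blast intro: order_trans)

lemma (in prob_space) moment_le_const:
  assumes "\<bar>d\<bar> \<le> a"
  shows "moment_le M 2 (\<lambda>_. d) a"
  using assms by (auto simp: moment_le_def prob_space abs_le_square_iff[symmetric])

text \<open>Jensen's inequality. It asks for no decorrelation and gains nothing from
  \<open>N\<close>; this suffices for the differences between Y and X, which are already of order
  \<rho> one by one.\<close>

lemma moment_le_average:
  assumes "\<And>n. n \<in> {1..N} \<Longrightarrow> moment_le M 2 (Z n) a" and "0 < N"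
  shows "moment_le M 2 (\<lambda>\<omega>. (1 / real N) * (\<Sum>n=1..N. Z n \<omega>)) a"
proof -
  have [measurable]: "\<And>n. n \<in> {1..N} \<Longrightarrow> Z n \<in> borel_measurable M"
    using assms by (auto simp: moment_le_def)
  let ?W = "\<lambda>\<omega>. (1 / real N) * (\<Sum>n=1..N. (Z n \<omega>)\<^sup>2)"
  show ?thesis
  proof (rule moment_le_bounded_by[where W = ?W])
    show "integrable M ?W" using assms
      by (intro integrable_mult_right Bochner_Integration.integrable_sum) (auto simp: moment_le_def)
    have "(LINT \<omega>|M. ?W \<omega>) = (1 / real N) * (\<Sum>n=1..N. LINT \<omega>|M. (Z n \<omega>)\<^sup>2)"
      using assms by (subst integral_mult_right_zero, subst Bochner_Integration.integral_sum)
        (auto simp: moment_le_def)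
    also have "\<dots> \<le> (1 / real N) * (\<Sum>n=1..N. a\<^sup>2)"
      using assms by (intro mult_left_mono sum_mono) (auto simp: moment_le_def)
    also have "\<dots> = a\<^sup>2" using assms by simp
    finally show "(LINT \<omega>|M. ?W \<omega>) \<le> a\<^sup>2" .
    fix \<omega>
    have "(\<Sum>n=1..N. Z n \<omega>)\<^sup>2 \<le> (\<Sum>n=1..N. (Z n \<omega>)\<^sup>2) * real N"
      using sum_squared_le_sum_of_squares[of "\<lambda>n. Z n \<omega>" "{1..N}"] by simp
    then show "((1 / real N) * (\<Sum>n=1..N. Z n \<omega>))\<^sup>2 \<le> ?W \<omega>"
      using assms(2) by (simp add: field_simps power2_eq_square)
  qed auto
qed

subsection \<open>Variance of averages of decorrelated variables\<close>

text \<open>In each row a given distance occurs at most twice, once on each side of the diagonal.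
  The diagonal itself is counted with the left side.\<close>

lemma sum_le_by_distance:
  fixes c :: "nat \<Rightarrow> nat \<Rightarrow> real" and g :: "nat \<Rightarrow> real"
  assumes le: "\<And>n m. n \<in> {1..N} \<Longrightarrow> m \<in> {1..N} \<Longrightarrow> n \<le> m \<Longrightarrow> c n m \<le> g (m - n)"
    and sym: "\<And>n m. c n m = c m n" and g0: "\<And>k. 0 \<le> g k"
  shows "(\<Sum>n=1..N. \<Sum>m=1..N. c n m) \<le> 2 * real N * (\<Sum>k<N. g k)"
proof -
  have row: "(\<Sum>m=1..N. c n m) \<le> 2 * (\<Sum>k<N. g k)" if n: "n \<in> {1..N}" for n
  proof -
    have split: "{1..N} = {1..n} \<union> {n<..N}" using n by auto
    have "(\<Sum>m=1..N. c n m) = (\<Sum>m=1..n. c n m) + (\<Sum>m\<in>{n<..N}. c n m)"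
      unfolding split by (intro sum.union_disjoint) auto
    also have "(\<Sum>m=1..n. c n m) \<le> (\<Sum>m=1..n. g (n - m))"
      using le sym n by (intro sum_mono) (metis atLeastAtMost_iff order_trans)
    also have "\<dots> = (\<Sum>k\<in>(\<lambda>m. n - m) ` {1..n}. g k)"
      by (subst sum.reindex) (auto simp: inj_on_def)
    also have "\<dots> \<le> (\<Sum>k<N. g k)"
      using n g0 by (intro sum_mono2) auto
    also have "(\<Sum>m\<in>{n<..N}. c n m) \<le> (\<Sum>m\<in>{n<..N}. g (m - n))"
      using le n by (intro sum_mono) auto
    also have "\<dots> = (\<Sum>k\<in>(\<lambda>m. m - n) ` {n<..N}. g k)"
      by (subst sum.reindex) (auto simp: inj_on_def)
    also have "\<dots> \<le> (\<Sum>k<N. g k)"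
      using n g0 by (intro sum_mono2) auto
    finally show ?thesis by simp
  qed
  have "(\<Sum>n=1..N. \<Sum>m=1..N. c n m) \<le> (\<Sum>n=1..N. 2 * (\<Sum>k<N. g k))"
    by (intro sum_mono row)
  then show ?thesis by simp
qed

text \<open>Integral test: since \<open>f\<close> decreases, each term times \<Delta> is at most the
  integral of \<open>f\<close> over the interval of length \<Delta> ending at that argument. These
  intervals are disjoint, and the condition on \<open>A\<close> keeps their left ends at or beyond
  1, where \<open>f\<close> is integrable.\<close>

lemma sum_le_integral_tail:
  fixes f :: "real \<Rightarrow> real"
  assumes anti: "antimono_on {0<..} f" and pos: "\<And>T. 0 < T \<Longrightarrow> 0 < f T"
    and int: "set_integrable lborel {1..} f" and \<Delta>: "0 < \<Delta>"
    and A: "finite A" "\<And>k. k \<in> A \<Longrightarrow> \<kappa> < k \<and> 1 \<le> (real k - real \<kappa> - 1) * \<Delta>"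
  shows "(\<Sum>k\<in>A. f ((real k - real \<kappa>) * \<Delta>)) \<le> (LINT x:{1..}|lborel. f x) / \<Delta>"
proof -
  let ?l = "\<lambda>k. (real k - real \<kappa> - 1) * \<Delta>" and ?r = "\<lambda>k. (real k - real \<kappa>) * \<Delta>"
  let ?I = "\<lambda>k::nat. {?l k <.. ?r k}"
  have lr: "?r k = ?l k + \<Delta>" for k by (simp add: algebra_simps)
  have sub: "?I k \<subseteq> {1..}" if "k \<in> A" for k using A(2)[OF that] by auto
  have disj: "?I k \<inter> ?I l = {}" if "k < l" for k l
  proof -
    have "?r k \<le> ?l l" using that \<Delta> by (intro mult_right_mono) auto
    then show ?thesis by auto
  qed
  have intk: "set_integrable lborel (?I k) f" if "k \<in> A" for k
    by (rule set_integrable_subset[OF int _ sub[OF that]]) auto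
  have "(\<Sum>k\<in>A. f (?r k)) * \<Delta> = (\<Sum>k\<in>A. LINT x:?I k|lborel. f (?r k))"
    unfolding sum_distrib_right using \<Delta>
    by (intro sum.cong refl) (simp add: lr set_lebesgue_integral_def algebra_simps)
  also have "\<dots> \<le> (\<Sum>k\<in>A. LINT x:?I k|lborel. f x)"
  proof (intro sum_mono set_integral_mono intk)
    fix k x assume k: "k \<in> A" and x: "x \<in> ?I k"
    have "0 < x" using x sub[OF k] by fastforce
    then show "f (?r k) \<le> f x" using x
      by (intro monotone_onD[OF anti]) auto
  next
    fix k assume "k \<in> A"
    show "set_integrable lborel (?I k) (\<lambda>x. f (?r k))"
      unfolding set_integrable_def using \<Delta> by (simp add: lr)
  qed
  also have "\<dots> = (LINT x:(\<Union>k\<in>A. ?I k)|lborel. f x)"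
    using A(1) intk disj
    by (intro set_integral_finite_Union[symmetric])
       (auto simp: disjoint_family_on_def, metis disj nat_neq_iff disjoint_iff greaterThanAtMost_iff)
  also have "\<dots> \<le> (LINT x:{1..}|lborel. f x)"
  proof -
    have "set_integrable lborel (\<Union>k\<in>A. ?I k) f"
      by (rule set_integrable_subset[OF int]) (use sub A(1) in auto)
    then show ?thesis
      unfolding set_lebesgue_integral_def using int[unfolded set_integrable_def] sub pos
    proof (intro integral_mono)
      fix x :: real
      show "indicat_real (\<Union>k\<in>A. ?I k) x *\<^sub>R f x \<le> indicat_real {1..} x *\<^sub>R f x"
      proof (cases "x \<in> {1..}")
        case True
        then show ?thesis using pos[of x] by (simp add: indicator_def)
      next
        case False
        then have "x \<notin> (\<Union>k\<in>A. ?I k)" using sub by blast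
        then show ?thesis using False by simp
      qed
    qed (auto simp: set_integrable_def)
  qed
  finally show ?thesis using \<Delta> by (simp add: field_simps)
qed

text \<open>The variable \<open>Z n\<close> may involve the grid points from n to n + \<kappa>, so
  decorrelation is available only for pairs with n + \<kappa> < k. Expanding the square gives N^2
  covariances; summed by distance they cost 2 N times a one-dimensional sum, which after division by
  N^2 is of order 1 / (N \<Delta>).\<close>

lemma (in prob_space) average_deviation:
  fixes Z :: "nat \<Rightarrow> 'a \<Rightarrow> real"
  assumes anti: "antimono_on {0<..} f" and pos: "\<And>T. 0 < T \<Longrightarrow> 0 < f T"
    and int: "set_integrable lborel {1..} f" and \<Delta>: "0 < \<Delta>" and N: "0 < N"
    and Z: "\<And>n. n \<in> {1..N} \<Longrightarrow> moment_le M 2 (Z n) b"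
    and mean: "\<And>n. n \<in> {1..N} \<Longrightarrow> expectation (Z n) = m"
    and decorr: "\<And>n k. n \<in> {1..N} \<Longrightarrow> k \<in> {1..N} \<Longrightarrow> n + \<kappa> < k \<Longrightarrow>
      \<bar>expectation (\<lambda>\<omega>. Z n \<omega> * Z k \<omega>) - m * m\<bar> \<le> f ((real k - real n - real \<kappa>) * \<Delta>)"
  shows "integrable M (\<lambda>\<omega>. ((1 / real N) * (\<Sum>n=1..N. Z n \<omega>) - m)\<^sup>2)" (is ?int)
    and "expectation (\<lambda>\<omega>. ((1 / real N) * (\<Sum>n=1..N. Z n \<omega>) - m)\<^sup>2) \<le>
      2 / (real N * \<Delta>) * (b\<^sup>2 * ((real \<kappa> + 2) * \<Delta> + 1) + (LINT x:{1..}|lborel. f x))" (is ?bound)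
proof -
  have meas [measurable]: "\<And>n. n \<in> {1..N} \<Longrightarrow> Z n \<in> borel_measurable M"
    using Z by (auto simp: moment_le_def)
  have int2: "integrable M (\<lambda>\<omega>. Z n \<omega> * Z k \<omega>)" 
    and le2: "expectation (\<lambda>\<omega>. Z n \<omega> * Z k \<omega>) \<le> b\<^sup>2" if "n \<in> {1..N}" "k \<in> {1..N}" for n k
  proof -
    let ?W = "\<lambda>\<omega>. ((Z n \<omega>)\<^sup>2 + (Z k \<omega>)\<^sup>2) / 2"
    have W: "integrable M ?W" using Z that by (auto simp: moment_le_def)
    have p: "\<bar>Z n \<omega> * Z k \<omega>\<bar> \<le> ?W \<omega>" for \<omega>
      using sum_squares_bound[of "\<bar>Z n \<omega>\<bar>" "\<bar>Z k \<omega>\<bar>"] by (simp add: abs_mult)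
    show i: "integrable M (\<lambda>\<omega>. Z n \<omega> * Z k \<omega>)"
      by (rule Bochner_Integration.integrable_bound[OF W]) 
         (use p that in \<open>auto intro!: AE_I2 intro: order_trans\<close>)
    have "expectation (\<lambda>\<omega>. Z n \<omega> * Z k \<omega>) \<le> expectation ?W"
      using p by (intro integral_mono i W) (meson abs_le_D1)
    also have "\<dots> = (expectation (\<lambda>\<omega>. (Z n \<omega>)\<^sup>2) + expectation (\<lambda>\<omega>. (Z k \<omega>)\<^sup>2)) / 2"
      using Z that by (simp add: moment_le_def)
    also have "\<dots> \<le> b\<^sup>2" using Z[OF that(1)] Z[OF that(2)] by (simp add: moment_le_def)
    finally show "expectation (\<lambda>\<omega>. Z n \<omega> * Z k \<omega>) \<le> b\<^sup>2" .
  qed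
  have int1: "integrable M (Z n)" if "n \<in> {1..N}" for n
    by (rule square_integrable_imp_integrable) (use Z that in \<open>auto simp: moment_le_def\<close>)
  define c where "c n k = expectation (\<lambda>\<omega>. Z n \<omega> * Z k \<omega>) - m * m" for n k
  have eq: "((1 / real N) * (\<Sum>n=1..N. Z n \<omega>) - m)\<^sup>2 =
      (\<Sum>n=1..N. \<Sum>k=1..N. (Z n \<omega> - m) * (Z k \<omega> - m)) / (real N)\<^sup>2" for \<omega>
  proof -
    have "(1 / real N) * (\<Sum>n=1..N. Z n \<omega>) - m = (\<Sum>n=1..N. Z n \<omega> - m) / real N"
      using N by (simp add: sum_subtractf field_simps)
    then show ?thesis by (simp add: power_divide power2_eq_square sum_product)
  qed
  have prod: "(Z n \<omega> - m) * (Z k \<omega> - m) = Z n \<omega> * Z k \<omega> - m * Z n \<omega> - m * Z k \<omega> + m * m" for n k \<omega>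
    by (simp add: algebra_simps)
  have intp: "integrable M (\<lambda>\<omega>. (Z n \<omega> - m) * (Z k \<omega> - m))" if "n \<in> {1..N}" "k \<in> {1..N}" for n k
    unfolding prod using int2 int1 that by auto
  show ?int unfolding eq
    by (intro integrable_divide Bochner_Integration.integrable_sum intp)
  have cov: "expectation (\<lambda>\<omega>. (Z n \<omega> - m) * (Z k \<omega> - m)) = c n k" if "n \<in> {1..N}" "k \<in> {1..N}" for n k
    unfolding prod c_def using int2 int1 that mean by (simp add: prob_space)
  \<comment> \<open>The threshold is the complement of the condition under which the integral test
    applies: the interval of length \<Delta> ending at (k - \<kappa>) \<Delta> must start at 1 or
    later, which accounts for the additional step in \<kappa> + 1.\<close>
  define g where "g k = (if real k * \<Delta> \<le> (real \<kappa> + 1) * \<Delta> + 1 then b\<^sup>2 else f ((real k - real \<kappa>) * \<Delta>))" for k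
  have kk: "\<kappa> < k \<and> 1 \<le> (real k - real \<kappa> - 1) * \<Delta>"
    if "\<not> real k * \<Delta> \<le> (real \<kappa> + 1) * \<Delta> + 1" for k
  proof -
    have *: "1 \<le> (real k - real \<kappa> - 1) * \<Delta>" using that by (simp add: algebra_simps)
    then have "0 < real k - real \<kappa> - 1" using \<Delta> by (metis zero_less_mult_pos2 less_le_trans zero_less_one)
    then show ?thesis using * by linarith
  qed
  have "expectation (\<lambda>\<omega>. ((1 / real N) * (\<Sum>n=1..N. Z n \<omega>) - m)\<^sup>2) = (\<Sum>n=1..N. \<Sum>k=1..N. c n k) / (real N)\<^sup>2"
  proof -
    have "expectation (\<lambda>\<omega>. \<Sum>n=1..N. \<Sum>k=1..N. (Z n \<omega> - m) * (Z k \<omega> - m)) =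
        (\<Sum>n=1..N. expectation (\<lambda>\<omega>. \<Sum>k=1..N. (Z n \<omega> - m) * (Z k \<omega> - m)))"
      by (intro Bochner_Integration.integral_sum Bochner_Integration.integrable_sum intp)
    also have "\<dots> = (\<Sum>n=1..N. \<Sum>k=1..N. c n k)"
    proof (intro sum.cong refl)
      fix n assume n: "n \<in> {1..N}"
      have "expectation (\<lambda>\<omega>. \<Sum>k=1..N. (Z n \<omega> - m) * (Z k \<omega> - m)) =
          (\<Sum>k=1..N. expectation (\<lambda>\<omega>. (Z n \<omega> - m) * (Z k \<omega> - m)))"
        by (intro Bochner_Integration.integral_sum intp n)
      also have "\<dots> = (\<Sum>k=1..N. c n k)" by (intro sum.cong refl cov n)
      finally show "expectation (\<lambda>\<omega>. \<Sum>k=1..N. (Z n \<omega> - m) * (Z k \<omega> - m)) = (\<Sum>k=1..N. c n k)" .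
    qed
    finally show ?thesis unfolding eq by simp
  qed
  also have "\<dots> \<le> (2 * real N * (\<Sum>k<N. g k)) / (real N)\<^sup>2"
  proof (intro divide_right_mono sum_le_by_distance)
    fix n k assume nk: "n \<in> {1..N}" "k \<in> {1..N}" "n \<le> k"
    show "c n k \<le> g (k - n)"
    proof (cases "real (k - n) * \<Delta> \<le> (real \<kappa> + 1) * \<Delta> + 1")
      case True
      \<comment> \<open>Subtracting \<open>m * m\<close> can only lower the covariance, so the raw
        second moment bound suffices for near pairs.\<close>
      have "c n k \<le> b\<^sup>2" using le2[OF nk(1,2)] zero_le_square[of m] unfolding c_def by linarith
      then show ?thesis using True by (simp add: g_def)
    next
      case False
      with kk have "n + \<kappa> < k" by fastforce
      then have "c n k \<le> f ((real k - real n - real \<kappa>) * \<Delta>)"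
        using decorr[OF nk(1,2)] by (simp add: c_def)
      then show ?thesis using False nk by (simp add: g_def of_nat_diff)
    qed
  next
    show "c n k = c k n" for n k by (simp add: c_def mult.commute)
    show "0 \<le> g k" for k using pos[of "(real k - real \<kappa>) * \<Delta>"] kk[of k] \<Delta> by (auto simp: g_def)
  qed simp
  also have "(\<Sum>k<N. g k) \<le> b\<^sup>2 * (real \<kappa> + 2 + 1 / \<Delta>) + (LINT x:{1..}|lborel. f x) / \<Delta>"
  proof -
    let ?S = "{k. k < N \<and> real k * \<Delta> \<le> (real \<kappa> + 1) * \<Delta> + 1}"
    let ?T = "{k. k < N \<and> \<not> real k * \<Delta> \<le> (real \<kappa> + 1) * \<Delta> + 1}"
    have "{..<N} = ?S \<union> ?T" by auto
    then have "(\<Sum>k<N. g k) = (\<Sum>k\<in>?S. g k) + (\<Sum>k\<in>?T. g k)"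
      by (simp only:) (intro sum.union_disjoint, auto)
    also have "(\<Sum>k\<in>?S. g k) = b\<^sup>2 * card ?S"
      by (simp add: g_def)
    also have "real (card ?S) \<le> real \<kappa> + 2 + 1 / \<Delta>"
    proof -
      \<comment> \<open>The largest near distance is at most \<open>?c\<close>; counting the
        distance 0 as well gives one more, hence \<kappa> + 2.\<close>
      let ?c = "real \<kappa> + 1 + 1 / \<Delta>"
      have "?S \<subseteq> {..nat \<lfloor>?c\<rfloor>}"
      proof
        fix k assume "k \<in> ?S"
        then have "real k \<le> ?c" using \<Delta> by (simp add: field_simps)
        then show "k \<in> {..nat \<lfloor>?c\<rfloor>}" unfolding atMost_iff by (rule le_nat_floor)
      qed
      then have "card ?S \<le> card {..nat \<lfloor>?c\<rfloor>}" by (intro card_mono) auto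
      moreover have "real (nat \<lfloor>?c\<rfloor>) \<le> ?c" using \<Delta> by (intro of_nat_floor) simp
      ultimately show ?thesis by simp
    qed
    also have "(\<Sum>k\<in>?T. g k) = (\<Sum>k\<in>?T. f ((real k - real \<kappa>) * \<Delta>))"
      by (intro sum.cong) (auto simp: g_def)
    also have "\<dots> \<le> (LINT x:{1..}|lborel. f x) / \<Delta>"
      using kk by (intro sum_le_integral_tail anti pos int \<Delta>) auto
    finally show ?thesis by (simp add: mult_left_mono)
  qed
  also have "2 * real N * (b\<^sup>2 * (real \<kappa> + 2 + 1 / \<Delta>) + (LINT x:{1..}|lborel. f x) / \<Delta>) / (real N)\<^sup>2 =
    2 / (real N * \<Delta>) * (b\<^sup>2 * ((real \<kappa> + 2) * \<Delta> + 1) + (LINT x:{1..}|lborel. f x))"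
    using N \<Delta> by (simp add: field_simps power2_eq_square)
  finally show ?bound using N by (simp add: divide_right_mono mult_left_mono)
qed

subsection \<open>Orders of stochastic convergence\<close>

text \<open>Only fourth moments are controlled, so the product of two empirical mean errors is small in \<open>L\<^sup>1\<close>
  but not in \<open>L\<^sup>2\<close>. The truncated order accommodates it, since \<open>min 1 x\<^sup>2 \<le> \<bar>x\<bar>\<close>.\<close>

definition L2_order :: "'a measure \<Rightarrow> (real \<Rightarrow> real) \<Rightarrow> (real \<Rightarrow> 'a \<Rightarrow> real) \<Rightarrow> bool" where
  "L2_order M \<rho> Z \<longleftrightarrow> (\<exists>C>0. \<forall>\<^sub>F \<epsilon> in at_right 0. moment_le M 2 (Z \<epsilon>) (C * \<rho> \<epsilon>))"

definition truncated_L2_order :: "'a measure \<Rightarrow> (real \<Rightarrow> real) \<Rightarrow> (real \<Rightarrow> 'a \<Rightarrow> real) \<Rightarrow> bool" where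
  "truncated_L2_order M \<rho> Z \<longleftrightarrow> (\<exists>C. \<forall>\<^sub>F \<epsilon> in at_right 0. Z \<epsilon> \<in> borel_measurable M \<and>
     (LINT \<omega>|M. min 1 ((Z \<epsilon> \<omega>)\<^sup>2)) \<le> C * (\<rho> \<epsilon>)\<^sup>2)"

lemma L2_order_add:
  assumes "L2_order M \<rho> U" "L2_order M \<rho> V" and "\<And>\<epsilon>. 0 < \<epsilon> \<Longrightarrow> 0 < \<rho> \<epsilon>"
  shows "L2_order M \<rho> (\<lambda>\<epsilon> \<omega>. U \<epsilon> \<omega> + V \<epsilon> \<omega>)"
proof -
  obtain C D where CD: "0 < C" "0 < D" "\<forall>\<^sub>F \<epsilon> in at_right 0. moment_le M 2 (U \<epsilon>) (C * \<rho> \<epsilon>)"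
      "\<forall>\<^sub>F \<epsilon> in at_right 0. moment_le M 2 (V \<epsilon>) (D * \<rho> \<epsilon>)"
    using assms by (auto simp: L2_order_def)
  have "\<forall>\<^sub>F \<epsilon> in at_right 0. moment_le M 2 (\<lambda>\<omega>. U \<epsilon> \<omega> + V \<epsilon> \<omega>) ((C + D) * \<rho> \<epsilon>)"
    using CD(3,4) eventually_at_right_less[of "0::real"]
  proof eventually_elim
    case (elim \<epsilon>)
    then show ?case
      using moment_le_add[of M "U \<epsilon>" "C * \<rho> \<epsilon>" "V \<epsilon>" "D * \<rho> \<epsilon>"] CD assms(3)
      by (simp add: algebra_simps)
  qed
  then show ?thesis unfolding L2_order_def using CD by (intro exI[of _ "C + D"]) auto
qed

lemma L2_order_cmult:
  assumes "L2_order M \<rho> U" and "\<And>\<epsilon>. 0 < \<epsilon> \<Longrightarrow> 0 < \<rho> \<epsilon>"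
  shows "L2_order M \<rho> (\<lambda>\<epsilon> \<omega>. d * U \<epsilon> \<omega>)"
proof -
  obtain C where C: "0 < C" "\<forall>\<^sub>F \<epsilon> in at_right 0. moment_le M 2 (U \<epsilon>) (C * \<rho> \<epsilon>)"
    using assms by (auto simp: L2_order_def)
  \<comment> \<open>The summand 1 keeps the constant positive when d = 0.\<close>
  have "\<forall>\<^sub>F \<epsilon> in at_right 0. moment_le M 2 (\<lambda>\<omega>. d * U \<epsilon> \<omega>) ((\<bar>d\<bar> * C + 1) * \<rho> \<epsilon>)"
    using C(2) eventually_at_right_less[of "0::real"]
  proof eventually_elim
    case (elim \<epsilon>)
    show ?case
      by (rule moment_le_mono[OF moment_le_cmult[OF elim(1), of d]])
        (use C assms(2)[OF elim(2)] in \<open>auto simp: algebra_simps\<close>)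
  qed
  then show ?thesis unfolding L2_order_def using C
    by (intro exI[of _ "\<bar>d\<bar> * C + 1"]) (auto simp: add_nonneg_pos)
qed

lemma (in prob_space) integrable_min_1:
  assumes [measurable]: "Z \<in> borel_measurable M" and "\<And>\<omega>. 0 \<le> Z \<omega>"
  shows "integrable M (\<lambda>\<omega>. min 1 (Z \<omega> :: real))"
  by (rule integrable_const_bound[where B = 1]) (use assms(2) in auto)

lemma (in prob_space) truncated_L2_order_L2:
  assumes "L2_order M \<rho> Z"
  shows "truncated_L2_order M \<rho> Z"
proof -
  obtain C where C: "0 < C" "\<forall>\<^sub>F \<epsilon> in at_right 0. moment_le M 2 (Z \<epsilon>) (C * \<rho> \<epsilon>)"
    using assms by (auto simp: L2_order_def)
  have "\<forall>\<^sub>F \<epsilon> in at_right 0. Z \<epsilon> \<in> borel_measurable M \<and>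
     (LINT \<omega>|M. min 1 ((Z \<epsilon> \<omega>)\<^sup>2)) \<le> C\<^sup>2 * (\<rho> \<epsilon>)\<^sup>2"
    using C(2)
  proof eventually_elim
    case (elim \<epsilon>)
    note Z = moment_leD[OF elim]
    have "(LINT \<omega>|M. min 1 ((Z \<epsilon> \<omega>)\<^sup>2)) \<le> (LINT \<omega>|M. (Z \<epsilon> \<omega>)\<^sup>2)"
      using Z by (intro integral_mono integrable_min_1) auto
    then show ?case using Z by (simp add: power_mult_distrib)
  qed
  then show ?thesis unfolding truncated_L2_order_def by blast
qed

text \<open>After the truncation, |U V| is at most (U^2 + V^2) / 2, so the two second moments are
  enough and no moment of the product is needed.\<close>

lemma (in prob_space) truncated_L2_order_mult:
  assumes "L2_order M \<rho> U" "L2_order M \<rho> V"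
  shows "truncated_L2_order M \<rho> (\<lambda>\<epsilon> \<omega>. U \<epsilon> \<omega> * V \<epsilon> \<omega>)"
proof -
  obtain C D where CD: "0 < C" "0 < D" "\<forall>\<^sub>F \<epsilon> in at_right 0. moment_le M 2 (U \<epsilon>) (C * \<rho> \<epsilon>)"
      "\<forall>\<^sub>F \<epsilon> in at_right 0. moment_le M 2 (V \<epsilon>) (D * \<rho> \<epsilon>)"
    using assms by (auto simp: L2_order_def)
  have "\<forall>\<^sub>F \<epsilon> in at_right 0. (\<lambda>\<omega>. U \<epsilon> \<omega> * V \<epsilon> \<omega>) \<in> borel_measurable M \<and>
     (LINT \<omega>|M. min 1 ((U \<epsilon> \<omega> * V \<epsilon> \<omega>)\<^sup>2)) \<le> (C\<^sup>2 + D\<^sup>2) * (\<rho> \<epsilon>)\<^sup>2"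
    using CD(3,4)
  proof eventually_elim
    case (elim \<epsilon>)
    note U = moment_leD[OF elim(1)] and V = moment_leD[OF elim(2)]
    note [measurable] = U(1) V(1)
    have p: "min 1 ((U \<epsilon> \<omega> * V \<epsilon> \<omega>)\<^sup>2) \<le> (U \<epsilon> \<omega>)\<^sup>2 + (V \<epsilon> \<omega>)\<^sup>2" for \<omega>
    proof -
      have "min 1 (x\<^sup>2) \<le> x" if "0 \<le> x" for x :: real
        using that mult_left_le[of x x] less_1_mult[of x x] by (cases "x \<le> 1") (auto simp: power2_eq_square min_def not_le)
      from this[of "\<bar>U \<epsilon> \<omega>\<bar> * \<bar>V \<epsilon> \<omega>\<bar>"]
      have "min 1 ((U \<epsilon> \<omega> * V \<epsilon> \<omega>)\<^sup>2) \<le> \<bar>U \<epsilon> \<omega>\<bar> * \<bar>V \<epsilon> \<omega>\<bar>"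
        by (simp add: power_mult_distrib)
      moreover have "2 * (\<bar>U \<epsilon> \<omega>\<bar> * \<bar>V \<epsilon> \<omega>\<bar>) \<le> (U \<epsilon> \<omega>)\<^sup>2 + (V \<epsilon> \<omega>)\<^sup>2"
        using sum_squares_bound[of "\<bar>U \<epsilon> \<omega>\<bar>" "\<bar>V \<epsilon> \<omega>\<bar>"] by (simp add: mult.assoc)
      moreover have "0 \<le> \<bar>U \<epsilon> \<omega>\<bar> * \<bar>V \<epsilon> \<omega>\<bar>" by simp
      ultimately show ?thesis by linarith
    qed
    have "(LINT \<omega>|M. min 1 ((U \<epsilon> \<omega> * V \<epsilon> \<omega>)\<^sup>2)) \<le> (LINT \<omega>|M. (U \<epsilon> \<omega>)\<^sup>2 + (V \<epsilon> \<omega>)\<^sup>2)"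
      using U V p by (intro integral_mono integrable_min_1) auto
    also have "\<dots> \<le> (C\<^sup>2 + D\<^sup>2) * (\<rho> \<epsilon>)\<^sup>2"
      using U V by (simp add: power_mult_distrib distrib_right)
    finally show ?case by simp
  qed
  then show ?thesis unfolding truncated_L2_order_def by blast
qed

lemma (in prob_space) truncated_L2_order_add:
  assumes "truncated_L2_order M \<rho> U" "truncated_L2_order M \<rho> V"
  shows "truncated_L2_order M \<rho> (\<lambda>\<epsilon> \<omega>. U \<epsilon> \<omega> + V \<epsilon> \<omega>)"
proof -
  obtain C D where C: "\<forall>\<^sub>F \<epsilon> in at_right 0. U \<epsilon> \<in> borel_measurable M \<and>
       (LINT \<omega>|M. min 1 ((U \<epsilon> \<omega>)\<^sup>2)) \<le> C * (\<rho> \<epsilon>)\<^sup>2"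
    and D: "\<forall>\<^sub>F \<epsilon> in at_right 0. V \<epsilon> \<in> borel_measurable M \<and>
       (LINT \<omega>|M. min 1 ((V \<epsilon> \<omega>)\<^sup>2)) \<le> D * (\<rho> \<epsilon>)\<^sup>2"
    using assms by (auto simp: truncated_L2_order_def)
  have "\<forall>\<^sub>F \<epsilon> in at_right 0. (\<lambda>\<omega>. U \<epsilon> \<omega> + V \<epsilon> \<omega>) \<in> borel_measurable M \<and>
     (LINT \<omega>|M. min 1 ((U \<epsilon> \<omega> + V \<epsilon> \<omega>)\<^sup>2)) \<le> (2 * C + 2 * D) * (\<rho> \<epsilon>)\<^sup>2"
    using C D
  proof eventually_elim
    case (elim \<epsilon>)
    then have [measurable]: "U \<epsilon> \<in> borel_measurable M" "V \<epsilon> \<in> borel_measurable M" by auto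
    have p: "min 1 ((U \<epsilon> \<omega> + V \<epsilon> \<omega>)\<^sup>2) \<le> 2 * min 1 ((U \<epsilon> \<omega>)\<^sup>2) + 2 * min 1 ((V \<epsilon> \<omega>)\<^sup>2)" for \<omega>
    proof -
      have "(U \<epsilon> \<omega> + V \<epsilon> \<omega>)\<^sup>2 \<le> 2 * (U \<epsilon> \<omega>)\<^sup>2 + 2 * (V \<epsilon> \<omega>)\<^sup>2"
        using sum_squares_bound[of "U \<epsilon> \<omega>" "V \<epsilon> \<omega>"] by (simp add: power2_sum)
      then show ?thesis
        using zero_le_power2[of "U \<epsilon> \<omega>"] zero_le_power2[of "V \<epsilon> \<omega>"] unfolding min_def by (smt (verit))
    qed
    have "(LINT \<omega>|M. min 1 ((U \<epsilon> \<omega> + V \<epsilon> \<omega>)\<^sup>2)) \<le>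
        (LINT \<omega>|M. 2 * min 1 ((U \<epsilon> \<omega>)\<^sup>2) + 2 * min 1 ((V \<epsilon> \<omega>)\<^sup>2))"
      using p by (intro integral_mono integrable_min_1 Bochner_Integration.integrable_add integrable_mult_right) auto
    also have "\<dots> = 2 * (LINT \<omega>|M. min 1 ((U \<epsilon> \<omega>)\<^sup>2)) + 2 * (LINT \<omega>|M. min 1 ((V \<epsilon> \<omega>)\<^sup>2))"
      by (simp add: integrable_min_1)
    also have "\<dots> \<le> (2 * C + 2 * D) * (\<rho> \<epsilon>)\<^sup>2" using elim by (simp add: algebra_simps)
    finally show ?case by simp
  qed
  then show ?thesis unfolding truncated_L2_order_def by blast
qed

section \<open>Rates and existence of sub-sampling schemes\<close>

lemma subsampling_scheme_bounds:
  assumes scheme: "subsampling_scheme \<rho> N \<Delta>" and pos: "\<And>\<epsilon>. 0 < \<epsilon> \<Longrightarrow> 0 < \<rho> \<epsilon>"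
    and lim: "(\<rho> \<longlongrightarrow> 0) (at_right 0)"
  obtains C where "0 < C" "\<forall>\<^sub>F \<epsilon> in at_right 0. 0 < \<epsilon> \<and> 1 / (real (N \<epsilon>) * \<Delta> \<epsilon>) \<le> C * (\<rho> \<epsilon>)\<^sup>2 \<and>
    \<Delta> \<epsilon> \<le> C * \<rho> \<epsilon>" "(\<Delta> \<longlongrightarrow> 0) (at_right 0)"
proof -
  obtain c1 c2 c3 where c: "0 < c1" "0 < c2" "0 < c3"
    and l1: "((\<lambda>\<epsilon>. real (N \<epsilon>) / (1 / \<rho> \<epsilon> ^ 3)) \<longlongrightarrow> c1) (at_right 0)"
    and l2: "((\<lambda>\<epsilon>. \<Delta> \<epsilon> / (1 / real (N \<epsilon>) powr (1 / 3))) \<longlongrightarrow> c2) (at_right 0)"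
    and l3: "((\<lambda>\<epsilon>. (1 / real (N \<epsilon>) powr (1 / 3)) / \<rho> \<epsilon>) \<longlongrightarrow> c3) (at_right 0)"
    using scheme by (auto simp: subsampling_scheme_def same_order_def)
  have N: "0 < N \<epsilon>" "0 < \<Delta> \<epsilon>" if "0 < \<epsilon>" for \<epsilon>
    using scheme that by (auto simp: subsampling_scheme_def)
  note ev = eventually_at_right_less[of "0::real"]
  \<comment> \<open>The factors N^(1/3) and N^(-1/3) of the last two ratios cancel.\<close>
  have l4: "((\<lambda>\<epsilon>. \<Delta> \<epsilon> / \<rho> \<epsilon>) \<longlongrightarrow> c2 * c3) (at_right 0)"
    by (rule Lim_transform_eventually[OF tendsto_mult[OF l2 l3]])
      (use ev in eventually_elim, use N in auto)
  \<comment> \<open>The quantity is the reciprocal of (N \<rho>^3) (\<Delta> / \<rho>), whose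
    factors converge to the positive limits \<open>c1\<close> and \<open>c2 * c3\<close>.\<close>
  have l5: "((\<lambda>\<epsilon>. 1 / (real (N \<epsilon>) * \<Delta> \<epsilon>) / (\<rho> \<epsilon>)\<^sup>2) \<longlongrightarrow> 1 / (c1 * (c2 * c3))) (at_right 0)"
  proof (rule Lim_transform_eventually)
    show "((\<lambda>\<epsilon>. 1 / ((real (N \<epsilon>) / (1 / \<rho> \<epsilon> ^ 3)) * (\<Delta> \<epsilon> / \<rho> \<epsilon>))) \<longlongrightarrow> 1 / (c1 * (c2 * c3))) (at_right 0)"
      using c by (intro tendsto_intros l1 l4) auto
    show "\<forall>\<^sub>F \<epsilon> in at_right 0. 1 / ((real (N \<epsilon>) / (1 / \<rho> \<epsilon> ^ 3)) * (\<Delta> \<epsilon> / \<rho> \<epsilon>)) =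
        1 / (real (N \<epsilon>) * \<Delta> \<epsilon>) / (\<rho> \<epsilon>)\<^sup>2"
      using ev by eventually_elim
        (use pos in \<open>auto simp: field_simps power2_eq_square power3_eq_cube\<close>)
  qed
  \<comment> \<open>Adding 1 puts \<open>C\<close> strictly above both limits, so both ratios are
    eventually below it.\<close>
  define C where "C = max (c2 * c3 + 1) (1 / (c1 * (c2 * c3)) + 1)"
  have "0 < C" using c by (auto simp: C_def less_max_iff_disj intro!: add_pos_pos)
  moreover have "\<forall>\<^sub>F \<epsilon> in at_right 0. 0 < \<epsilon> \<and> 1 / (real (N \<epsilon>) * \<Delta> \<epsilon>) \<le> C * (\<rho> \<epsilon>)\<^sup>2 \<and> \<Delta> \<epsilon> \<le> C * \<rho> \<epsilon>"
  proof -
    have "\<forall>\<^sub>F \<epsilon> in at_right 0. \<Delta> \<epsilon> / \<rho> \<epsilon> < C"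
      by (rule order_tendstoD[OF l4]) (simp add: C_def less_max_iff_disj)
    moreover have "\<forall>\<^sub>F \<epsilon> in at_right 0. 1 / (real (N \<epsilon>) * \<Delta> \<epsilon>) / (\<rho> \<epsilon>)\<^sup>2 < C"
      by (rule order_tendstoD[OF l5]) (simp add: C_def less_max_iff_disj)
    ultimately show ?thesis using ev
    proof eventually_elim
      case (elim \<epsilon>)
      have "0 < \<rho> \<epsilon>" using pos elim by auto
      then have "0 < (\<rho> \<epsilon>)\<^sup>2" by simp
      with \<open>0 < \<rho> \<epsilon>\<close> show ?case using elim by (simp add: pos_divide_less_eq[symmetric] less_imp_le)
    qed
  qed
  moreover have "(\<Delta> \<longlongrightarrow> 0) (at_right 0)"
  proof (rule Lim_transform_eventually)
    show "((\<lambda>\<epsilon>. (\<Delta> \<epsilon> / \<rho> \<epsilon>) * \<rho> \<epsilon>) \<longlongrightarrow> 0) (at_right 0)"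
      using tendsto_mult[OF l4 lim] by simp
    show "\<forall>\<^sub>F \<epsilon> in at_right 0. (\<Delta> \<epsilon> / \<rho> \<epsilon>) * \<rho> \<epsilon> = \<Delta> \<epsilon>"
      using ev by eventually_elim (use pos in force)
  qed
  ultimately show ?thesis by (rule that)
qed

text \<open>Needed because the first claim asserts that estimators exist before any scheme is given.
  Rounding 1 / \<rho>^3 up keeps N positive and changes the first ratio by at most \<rho>^3, which
  vanishes; \<Delta> is taken to be exactly N^(-1/3).\<close>

lemma subsampling_scheme_exists:
  assumes pos: "\<And>\<epsilon>. 0 < \<epsilon> \<Longrightarrow> 0 < \<rho> \<epsilon>" and lim: "(\<rho> \<longlongrightarrow> 0) (at_right 0)"
  obtains N \<Delta> where "subsampling_scheme \<rho> N \<Delta>"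
proof -
  define N where "N \<epsilon> = nat \<lceil>1 / \<rho> \<epsilon> ^ 3\<rceil>" for \<epsilon>
  define \<Delta> where "\<Delta> \<epsilon> = 1 / real (N \<epsilon>) powr (1 / 3)" for \<epsilon>
  note ev = eventually_at_right_less[of "0::real"]
  have N: "0 < N \<epsilon>" "1 / \<rho> \<epsilon> ^ 3 \<le> real (N \<epsilon>)" "real (N \<epsilon>) \<le> 1 / \<rho> \<epsilon> ^ 3 + 1" if "0 < \<epsilon>" for \<epsilon>
  proof -
    have p: "0 < 1 / \<rho> \<epsilon> ^ 3" using pos[OF that] by simp
    then show "0 < N \<epsilon>" by (simp add: N_def)
    show "1 / \<rho> \<epsilon> ^ 3 \<le> real (N \<epsilon>)" unfolding N_def by (rule real_nat_ceiling_ge)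
    show "real (N \<epsilon>) \<le> 1 / \<rho> \<epsilon> ^ 3 + 1" unfolding N_def using p by linarith
  qed
  have l1: "((\<lambda>\<epsilon>. real (N \<epsilon>) / (1 / \<rho> \<epsilon> ^ 3)) \<longlongrightarrow> 1) (at_right 0)"
  proof (rule tendsto_sandwich)
    show "\<forall>\<^sub>F \<epsilon> in at_right 0. 1 \<le> real (N \<epsilon>) / (1 / \<rho> \<epsilon> ^ 3)"
      using ev by eventually_elim (use N pos in \<open>auto simp: field_simps\<close>)
    show "\<forall>\<^sub>F \<epsilon> in at_right 0. real (N \<epsilon>) / (1 / \<rho> \<epsilon> ^ 3) \<le> 1 + \<rho> \<epsilon> ^ 3"
      using ev
    proof eventually_elim
      case (elim \<epsilon>)
      have "real (N \<epsilon>) * \<rho> \<epsilon> ^ 3 \<le> (1 / \<rho> \<epsilon> ^ 3 + 1) * \<rho> \<epsilon> ^ 3"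
        using N pos elim by (intro mult_right_mono) (auto simp: less_imp_le)
      then show ?case using pos[OF elim] by (simp add: distrib_right)
    qed
    show "((\<lambda>\<epsilon>. 1 + \<rho> \<epsilon> ^ 3) \<longlongrightarrow> 1) (at_right 0)"
      using tendsto_add[OF tendsto_const tendsto_power[OF lim, of 3], of 1] by simp
  qed simp
  have l2: "((\<lambda>\<epsilon>. \<Delta> \<epsilon> / (1 / real (N \<epsilon>) powr (1 / 3))) \<longlongrightarrow> 1) (at_right 0)"
    by (rule Lim_transform_eventually[OF tendsto_const])
      (use ev in eventually_elim, use N in \<open>auto simp: \<Delta>_def\<close>)
  have l3: "((\<lambda>\<epsilon>. (1 / real (N \<epsilon>) powr (1 / 3)) / \<rho> \<epsilon>) \<longlongrightarrow> 1) (at_right 0)"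
  proof (rule Lim_transform_eventually)
    \<comment> \<open>The third ratio is the first one raised to the power -1/3, so its limit needs
      no separate estimate.\<close>
    show "((\<lambda>\<epsilon>. (real (N \<epsilon>) / (1 / \<rho> \<epsilon> ^ 3)) powr - (1 / 3)) \<longlongrightarrow> 1) (at_right 0)"
      using tendsto_powr[OF l1 tendsto_const, of "- (1 / 3)"] by simp
    show "\<forall>\<^sub>F \<epsilon> in at_right 0. (real (N \<epsilon>) / (1 / \<rho> \<epsilon> ^ 3)) powr - (1 / 3) =
        (1 / real (N \<epsilon>) powr (1 / 3)) / \<rho> \<epsilon>"
      using ev
    proof eventually_elim
      case (elim \<epsilon>)
      have "(\<rho> \<epsilon> ^ 3) powr - (1 / 3) = 1 / \<rho> \<epsilon>"
      proof -
        have "\<rho> \<epsilon> ^ 3 = \<rho> \<epsilon> powr 3" using pos[OF elim] by simp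
        then have "(\<rho> \<epsilon> ^ 3) powr - (1 / 3) = \<rho> \<epsilon> powr (- 1)" by (simp only: powr_powr) simp
        then show ?thesis using pos[OF elim] by (simp add: powr_minus_divide)
      qed
      then show ?case using pos[OF elim] N[OF elim]
        by (simp add: powr_mult powr_minus_divide)
    qed
  qed
  have "subsampling_scheme \<rho> N \<Delta>"
    unfolding subsampling_scheme_def same_order_def
  proof (intro conjI allI impI exI[of _ "1::real"] l1 l2 l3)
    show "0 < N \<epsilon>" "0 < \<Delta> \<epsilon>" if "0 < \<epsilon>" for \<epsilon>
      using N(1)[OF that] by (auto simp: \<Delta>_def)
  qed auto
  then show ?thesis by (rule that)
qed

subsection \<open>Empirical moments of a sub-sampled process\<close>

text \<open>The setup at one fixed parameter: M, X, Y and f stand for their values at \<theta>.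
  Since the limits are taken with \<theta> fixed, the constants obtained here may depend on
  it.\<close>

locale subsampled_process = prob_space M for M :: "'a measure" +
  fixes X :: "real \<Rightarrow> 'a \<Rightarrow> real ^ 'r"
    and Y :: "real \<Rightarrow> real \<Rightarrow> 'a \<Rightarrow> real ^ 'r"
    and \<rho> f :: "real \<Rightarrow> real" and N :: "real \<Rightarrow> nat" and \<Delta> :: "real \<Rightarrow> real"
  assumes stationary: "strictly_stationary M X"
    and decorrelation: "integrable_decorrelation_rate M X f"
    and Y_measurable: "0 < \<epsilon> \<Longrightarrow> 0 \<le> t \<Longrightarrow> Y \<epsilon> t \<in> borel_measurable M"
    and Y_bounded: "\<exists>B. \<forall>\<epsilon>>0. \<forall>t\<ge>0. Lp_norm_le M 4 (Y \<epsilon> t) B"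
    and Y_approx: "0 < \<epsilon> \<Longrightarrow> 0 \<le> t \<Longrightarrow> Lp_norm_le M 4 (\<lambda>\<omega>. Y \<epsilon> t \<omega> - X t \<omega>) (\<rho> \<epsilon>)"
    and rho_pos: "0 < \<epsilon> \<Longrightarrow> 0 < \<rho> \<epsilon>"
    and rho_tendsto: "(\<rho> \<longlongrightarrow> 0) (at_right 0)"
    and scheme: "subsampling_scheme \<rho> N \<Delta>"
    and cov_Lipschitz: "0 \<le> u \<Longrightarrow> \<exists>\<delta>>0. \<exists>L. L-lipschitz_on (cball u \<delta> \<inter> {0..}) (lagged_cov M X)"
begin

abbreviation \<mu> where "\<mu> \<equiv> proc_mean M X"

lemma scheme_pos: "0 < \<epsilon> \<Longrightarrow> 0 < N \<epsilon>" "0 < \<epsilon> \<Longrightarrow> 0 < \<Delta> \<epsilon>"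
  using scheme by (auto simp: subsampling_scheme_def)

lemma X_measurable: "0 \<le> t \<Longrightarrow> X t \<in> borel_measurable M"
  using stationary by (auto simp: strictly_stationary_def)

lemma uniform_moment_bound:
  obtains b where "0 < b" "\<And>t i. 0 \<le> t \<Longrightarrow> moment_le M 4 (\<lambda>\<omega>. X t \<omega> $ i) b"
    "\<And>\<epsilon> t i. 0 < \<epsilon> \<Longrightarrow> 0 \<le> t \<Longrightarrow> moment_le M 4 (\<lambda>\<omega>. Y \<epsilon> t \<omega> $ i) b"
proof -
  from decorrelation have "\<exists>B. \<forall>t\<ge>0. Lp_norm_le M 4 (X t) B"
    unfolding integrable_decorrelation_rate_def by (rule conjunct1)
  then obtain B where B: "\<And>t. 0 \<le> t \<Longrightarrow> Lp_norm_le M 4 (X t) B" by metis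
  obtain B' where B': "\<And>\<epsilon> t. 0 < \<epsilon> \<Longrightarrow> 0 \<le> t \<Longrightarrow> Lp_norm_le M 4 (Y \<epsilon> t) B'"
    using Y_bounded by metis
  \<comment> \<open>The 1 makes the common bound positive, as the weighted inequalities for products
    and sums require.\<close>
  let ?b = "max 1 (max B B')"
  have "Lp_norm_le M 4 (X t) ?b" if "0 \<le> t" for t using B[OF that] by (auto simp: Lp_norm_le_def)
  moreover have "Lp_norm_le M 4 (Y \<epsilon> t) ?b" if "0 < \<epsilon>" "0 \<le> t" for \<epsilon> t
    using B'[OF that] by (auto simp: Lp_norm_le_def)
  ultimately have "moment_le M 4 (\<lambda>\<omega>. X t \<omega> $ i) ?b"
    "0 < \<epsilon> \<Longrightarrow> moment_le M 4 (\<lambda>\<omega>. Y \<epsilon> t \<omega> $ i) ?b" if "0 \<le> t" for t i \<epsilon>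
    using that by (auto intro!: Lp_norm_le_component X_measurable Y_measurable)
  then show ?thesis by (intro that[of ?b]) auto
qed

lemma X_integrable: "0 \<le> t \<Longrightarrow> integrable M (\<lambda>\<omega>. X t \<omega> $ i)"
proof -
  assume t: "0 \<le> t"
  obtain b where b: "0 < b" "\<And>t i. 0 \<le> t \<Longrightarrow> moment_le M 4 (\<lambda>\<omega>. X t \<omega> $ i) b"
    using uniform_moment_bound by metis
  have "moment_le M 2 (\<lambda>\<omega>. X t \<omega> $ i) b" using b t by (intro moment_le_4_2)
  from moment_leD(1,2)[OF this] show ?thesis by (rule square_integrable_imp_integrable)
qed

lemma X_product_integrable:
  assumes "0 \<le> s" "0 \<le> t"
  shows "integrable M (\<lambda>\<omega>. X s \<omega> $ i * X t \<omega> $ j)"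
proof -
  obtain b where b: "0 < b" "\<And>t i. 0 \<le> t \<Longrightarrow> moment_le M 4 (\<lambda>\<omega>. X t \<omega> $ i) b"
    using uniform_moment_bound by metis
  have "moment_le M 2 (\<lambda>\<omega>. X s \<omega> $ i * X t \<omega> $ j) (b * b)"
    using b assms by (intro moment_le_mult)
  from moment_leD(1,2)[OF this] show ?thesis by (rule square_integrable_imp_integrable)
qed

lemma expectation_shift:
  fixes h :: "(real \<Rightarrow> real ^ 'r) \<Rightarrow> real"
  assumes "finite J" "J \<subseteq> {0..}" "0 \<le> s" and [measurable]: "h \<in> borel_measurable (PiM J (\<lambda>_. borel))"
  shows "expectation (\<lambda>\<omega>. h (\<lambda>t\<in>J. X (t + s) \<omega>)) = expectation (\<lambda>\<omega>. h (\<lambda>t\<in>J. X t \<omega>))"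
proof -
  have [measurable]: "(\<lambda>\<omega>. \<lambda>t\<in>J. X (t + s) \<omega>) \<in> measurable M (PiM J (\<lambda>_. borel))"
      "(\<lambda>\<omega>. \<lambda>t\<in>J. X t \<omega>) \<in> measurable M (PiM J (\<lambda>_. borel))"
    using assms by (auto intro!: measurable_restrict X_measurable)
  have "distr M (PiM J (\<lambda>_. borel)) (\<lambda>\<omega>. \<lambda>t\<in>J. X (t + s) \<omega>) =
      distr M (PiM J (\<lambda>_. borel)) (\<lambda>\<omega>. \<lambda>t\<in>J. X t \<omega>)"
    using stationary assms(1,2,3) unfolding strictly_stationary_def by blast
  then have "integral\<^sup>L (distr M (PiM J (\<lambda>_. borel)) (\<lambda>\<omega>. \<lambda>t\<in>J. X (t + s) \<omega>)) h =
      integral\<^sup>L (distr M (PiM J (\<lambda>_. borel)) (\<lambda>\<omega>. \<lambda>t\<in>J. X t \<omega>)) h" by simp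
  then show ?thesis by (simp add: integral_distr)
qed

lemma expectation_X:
  assumes "0 \<le> t"
  shows "expectation (\<lambda>\<omega>. X t \<omega> $ i) = \<mu> $ i"
proof -
  have "expectation (\<lambda>\<omega>. X t \<omega> $ i) = expectation (\<lambda>\<omega>. X 0 \<omega> $ i)"
    using expectation_shift[of "{0}" t "\<lambda>v. v 0 $ i"] assms by simp
  then show ?thesis
    by (simp add: proc_mean_def integral_vec_nth integrable_vec X_integrable)
qed

lemma expectation_X_product:
  assumes "0 \<le> s" "0 \<le> u"
  shows "expectation (\<lambda>\<omega>. X s \<omega> $ i * X (s + u) \<omega> $ j) = lagged_cov M X u $ i $ j + \<mu> $ i * \<mu> $ j"
proof -
  have "expectation (\<lambda>\<omega>. X s \<omega> $ i * X (s + u) \<omega> $ j) = expectation (\<lambda>\<omega>. X 0 \<omega> $ i * X u \<omega> $ j)"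
    using expectation_shift[of "{0, u}" s "\<lambda>v. v 0 $ i * v u $ j"] assms by (simp add: add.commute)
  moreover have "integrable M (\<lambda>\<omega>. outer (X 0 \<omega>) (X u \<omega>))"
    using assms by (intro integrable_vec) (simp add: outer_def X_product_integrable)
  ultimately show ?thesis
    using assms by (simp add: lagged_cov_def integral_vec_nth integrable_vec X_product_integrable outer_def)
qed

lemma decorrelation_windows:
  assumes "0 \<le> a" "a \<le> b" "b < c" "c \<le> d"
    and "G \<in> low_order_products X {a..b}" "H \<in> low_order_products X {c..d}"
  shows "\<bar>expectation (\<lambda>\<omega>. G \<omega> * H \<omega>) - expectation G * expectation H\<bar> \<le> f (c - b)"
proof -
  have gap: "(INF (u, v)\<in>{a..b} \<times> {c..d}. v - u) = c - b"
  proof (rule cInf_eq_minimum)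
    show "c - b \<in> (\<lambda>(u, v). v - u) ` ({a..b} \<times> {c..d})"
      using assms by (intro image_eqI[of _ _ "(b, c)"]) auto
  qed auto
  have "\<forall>U V T. is_interval U \<and> is_interval V \<and> U \<noteq> {} \<and> V \<noteq> {} \<and> U \<subseteq> {0..} \<and> V \<subseteq> {0..} \<and>
        (\<forall>u\<in>U. \<forall>v\<in>V. u < v) \<and> T = (INF (u, v)\<in>U \<times> V. v - u) \<and> 0 < T \<longrightarrow>
        (\<forall>G\<in>low_order_products X U. \<forall>H\<in>low_order_products X V.
           \<bar>expectation (\<lambda>\<omega>. G \<omega> * H \<omega>) - expectation G * expectation H\<bar> \<le> f T)"
    using decorrelation unfolding integrable_decorrelation_rate_def by (elim conjE)
  note this[THEN spec, of "{a..b}", THEN spec, of "{c..d}", THEN spec, of "c - b"]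
  moreover have "is_interval {a..b}" "is_interval {c..d}" "{a..b} \<noteq> {}" "{c..d} \<noteq> {}"
    "{a..b} \<subseteq> {0..}" "{c..d} \<subseteq> {0..}" "\<forall>u\<in>{a..b}. \<forall>v\<in>{c..d}. u < v" "0 < c - b"
    using assms by (auto simp: is_interval_cc)
  ultimately show ?thesis using assms(5,6) gap by (metis (no_types, lifting))
qed

text \<open>Here \<open>k\<close> shifts the whole grid, \<open>\<kappa>\<close> is the number of
  steps spanned by one variable, and \<open>m\<close> may vary with \<epsilon> because the rounded
  lag does. The step count \<open>\<kappa>\<close> may grow without bound as \<Delta> shrinks; only
  the time \<open>\<kappa> * \<Delta>\<close> has to stay bounded for the variance to be of order 1
  / (N \<Delta>), hence of order \<rho>^2.\<close>

lemma deviation_L2_order: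
  fixes Z :: "real \<Rightarrow> nat \<Rightarrow> 'a \<Rightarrow> real"
  assumes Z: "\<And>\<epsilon> n. 0 < \<epsilon> \<Longrightarrow>
      Z \<epsilon> n \<in> low_order_products X {real (n + k \<epsilon>) * \<Delta> \<epsilon> .. real (n + k \<epsilon> + \<kappa> \<epsilon>) * \<Delta> \<epsilon>}"
    and mean: "\<And>\<epsilon> n. 0 < \<epsilon> \<Longrightarrow> expectation (Z \<epsilon> n) = m \<epsilon>"
    and window: "\<forall>\<^sub>F \<epsilon> in at_right 0. real (\<kappa> \<epsilon>) * \<Delta> \<epsilon> \<le> w"
    and moment: "\<And>\<epsilon> n. 0 < \<epsilon> \<Longrightarrow> moment_le M 2 (Z \<epsilon> n) b"
  shows "L2_order M \<rho> (\<lambda>\<epsilon> \<omega>. (1 / real (N \<epsilon>)) * (\<Sum>n=1..N \<epsilon>. Z \<epsilon> n \<omega>) - m \<epsilon>)"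
proof -
  have "\<forall>T>0. 0 < f T" and anti: "antimono_on {0<..} f" and int: "set_integrable lborel {1..} f"
    subgoal using decorrelation unfolding integrable_decorrelation_rate_def by (elim conjE)
    subgoal using decorrelation unfolding integrable_decorrelation_rate_def by (elim conjE)
    subgoal using decorrelation unfolding integrable_decorrelation_rate_def by (elim conjE)
    done
  then have pos: "\<And>T. 0 < T \<Longrightarrow> 0 < f T" by simp
  note f = pos anti int
  obtain C where C: "0 < C" "\<forall>\<^sub>F \<epsilon> in at_right 0. 0 < \<epsilon> \<and> 1 / (real (N \<epsilon>) * \<Delta> \<epsilon>) \<le> C * (\<rho> \<epsilon>)\<^sup>2 \<and>
      \<Delta> \<epsilon> \<le> C * \<rho> \<epsilon>" and \<Delta>0: "(\<Delta> \<longlongrightarrow> 0) (at_right 0)"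
    using subsampling_scheme_bounds[OF scheme rho_pos rho_tendsto] .
  have \<Delta>1: "\<forall>\<^sub>F \<epsilon> in at_right 0. \<Delta> \<epsilon> < 1"
    using order_tendstoD(2)[OF \<Delta>0, of 1] by simp
  define I where "I = (LINT x:{1..}|lborel. f x)"
  \<comment> \<open>Once \<Delta> < 1, the factor (\<kappa> + 2) \<Delta> + 1 is at most |w| + 3;
    the factor 2 C comes from 2 / (N \<Delta>). Passing to D + 1 later makes the constant
    positive.\<close>
  define D where "D = 2 * C * (b\<^sup>2 * (\<bar>w\<bar> + 3) + I)"
  have I: "0 \<le> I" unfolding I_def set_lebesgue_integral_def
    using f(1) by (intro Bochner_Integration.integral_nonneg) (auto simp: indicator_def less_imp_le)
  then have D: "0 \<le> D" using C(1) by (simp add: D_def)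
  have "\<forall>\<^sub>F \<epsilon> in at_right 0. moment_le M 2
      (\<lambda>\<omega>. (1 / real (N \<epsilon>)) * (\<Sum>n=1..N \<epsilon>. Z \<epsilon> n \<omega>) - m \<epsilon>) (sqrt (D + 1) * \<rho> \<epsilon>)"
    using C(2) \<Delta>1 window
  proof eventually_elim
    case (elim \<epsilon>)
    then have \<epsilon>: "0 < \<epsilon>" by simp
    note pos = scheme_pos[OF \<epsilon>]
    let ?W = "\<lambda>\<omega>. (1 / real (N \<epsilon>)) * (\<Sum>n=1..N \<epsilon>. Z \<epsilon> n \<omega>) - m \<epsilon>"
    \<comment> \<open>The gap runs from the end of the window of \<open>n\<close>, at step n + k +
      \<kappa>, to the start of the window of \<open>l\<close>, at step l + k; the shift
      cancels.\<close>
    have dec: "\<bar>expectation (\<lambda>\<omega>. Z \<epsilon> n \<omega> * Z \<epsilon> l \<omega>) - m \<epsilon> * m \<epsilon>\<bar>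
        \<le> f ((real l - real n - real (\<kappa> \<epsilon>)) * \<Delta> \<epsilon>)" if "n + \<kappa> \<epsilon> < l" for n l
    proof -
      have "\<bar>expectation (\<lambda>\<omega>. Z \<epsilon> n \<omega> * Z \<epsilon> l \<omega>) - expectation (Z \<epsilon> n) * expectation (Z \<epsilon> l)\<bar>
          \<le> f (real (l + k \<epsilon>) * \<Delta> \<epsilon> - real (n + k \<epsilon> + \<kappa> \<epsilon>) * \<Delta> \<epsilon>)"
        using that pos by (intro decorrelation_windows[OF _ _ _ _ Z[OF \<epsilon>] Z[OF \<epsilon>]]) 
          (auto intro!: mult_right_mono mult_strict_right_mono simp del: of_nat_add)
      moreover have "real (l + k \<epsilon>) * \<Delta> \<epsilon> - real (n + k \<epsilon> + \<kappa> \<epsilon>) * \<Delta> \<epsilon> = (real l - real n - real (\<kappa> \<epsilon>)) * \<Delta> \<epsilon>"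
        by (simp add: algebra_simps)
      ultimately show ?thesis using mean[OF \<epsilon>] by simp
    qed
    note dev = average_deviation[OF f(2,1,3) pos(2,1), of "Z \<epsilon>" b "m \<epsilon>" "\<kappa> \<epsilon>", folded I_def]
    have "integrable M (\<lambda>\<omega>. (?W \<omega>)\<^sup>2)"
      by (rule dev(1)) (use moment[OF \<epsilon>] mean[OF \<epsilon>] dec in auto)
    moreover have "expectation (\<lambda>\<omega>. (?W \<omega>)\<^sup>2) \<le> (sqrt (D + 1) * \<rho> \<epsilon>)\<^sup>2"
    proof -
      have "expectation (\<lambda>\<omega>. (?W \<omega>)\<^sup>2) \<le>
          2 / (real (N \<epsilon>) * \<Delta> \<epsilon>) * (b\<^sup>2 * ((real (\<kappa> \<epsilon>) + 2) * \<Delta> \<epsilon> + 1) + I)"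
        by (rule dev(2)) (use moment[OF \<epsilon>] mean[OF \<epsilon>] dec in auto)
      also have "\<dots> \<le> 2 / (real (N \<epsilon>) * \<Delta> \<epsilon>) * (b\<^sup>2 * (\<bar>w\<bar> + 3) + I)"
      proof -
        have "(real (\<kappa> \<epsilon>) + 2) * \<Delta> \<epsilon> + 1 = real (\<kappa> \<epsilon>) * \<Delta> \<epsilon> + 2 * \<Delta> \<epsilon> + 1"
          by (simp add: algebra_simps)
        also have "\<dots> \<le> \<bar>w\<bar> + 3" using elim by linarith
        finally show ?thesis using pos by (intro mult_left_mono add_right_mono) auto
      qed
      also have "\<dots> = 2 * (1 / (real (N \<epsilon>) * \<Delta> \<epsilon>)) * (b\<^sup>2 * (\<bar>w\<bar> + 3) + I)" by simp
      also have "\<dots> \<le> 2 * (C * (\<rho> \<epsilon>)\<^sup>2) * (b\<^sup>2 * (\<bar>w\<bar> + 3) + I)"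
        using elim I by (intro mult_right_mono mult_left_mono) auto
      also have "\<dots> = D * (\<rho> \<epsilon>)\<^sup>2"
        by (simp add: D_def algebra_simps)
      also have "\<dots> \<le> (D + 1) * (\<rho> \<epsilon>)\<^sup>2" by (simp add: algebra_simps)
      also have "\<dots> = (sqrt (D + 1) * \<rho> \<epsilon>)\<^sup>2" using D by (simp add: power_mult_distrib)
      finally show ?thesis .
    qed
    moreover have "?W \<in> borel_measurable M"
      by (intro borel_measurable_diff borel_measurable_times borel_measurable_const
          borel_measurable_sum moment_leD(1)[OF moment[OF \<epsilon>]])
    ultimately show ?case by (simp add: moment_le_def)
  qed
  then show ?thesis unfolding L2_order_def using D by (intro exI[of _ "sqrt (D + 1)"] conjI) simp_all
qed

lemma moment_le_error: "0 < \<epsilon> \<Longrightarrow> 0 \<le> t \<Longrightarrow> moment_le M 4 (\<lambda>\<omega>. Y \<epsilon> t \<omega> $ i - X t \<omega> $ i) (\<rho> \<epsilon>)"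
proof -
  assume "0 < \<epsilon>" "0 \<le> t"
  then have "moment_le M 4 (\<lambda>\<omega>. (Y \<epsilon> t \<omega> - X t \<omega>) $ i) (\<rho> \<epsilon>)"
    by (intro Lp_norm_le_component borel_measurable_diff Y_measurable X_measurable Y_approx) simp_all
  then show ?thesis by simp
qed

lemma L2_orderI:
  assumes "\<And>\<epsilon>. 0 < \<epsilon> \<Longrightarrow> moment_le M 2 (Z \<epsilon>) (C * \<rho> \<epsilon>)" "0 < C"
  shows "L2_order M \<rho> Z"
  unfolding L2_order_def
proof (intro exI[of _ C] conjI)
  show "\<forall>\<^sub>F \<epsilon> in at_right 0. moment_le M 2 (Z \<epsilon>) (C * \<rho> \<epsilon>)"
    using eventually_at_right_less[of "0::real"] by (rule eventually_mono) (rule assms)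
qed (rule assms)

text \<open>The error splits into the average of Y - X, controlled termwise, and the fluctuation of
  the average of X. By stationarity the shift \<open>k\<close> does not change the centre, so the
  result serves both for the plain mean and for the mean shifted by the lag.\<close>

lemma emp_mean_L2_order:
  "L2_order M \<rho> (\<lambda>\<epsilon> \<omega>. emp_mean (N \<epsilon>) (\<Delta> \<epsilon>) (k \<epsilon>) (\<lambda>t. Y \<epsilon> t \<omega>) $ i - \<mu> $ i)"
proof -
  obtain b where b: "0 < b" "\<And>t i. 0 \<le> t \<Longrightarrow> moment_le M 4 (\<lambda>\<omega>. X t \<omega> $ i) b"
    using uniform_moment_bound by metis
  let ?t = "\<lambda>\<epsilon> n. real (n + k \<epsilon>) * \<Delta> \<epsilon>"
  have t: "0 \<le> ?t \<epsilon> n" if "0 < \<epsilon>" for \<epsilon> n using scheme_pos[OF that] by simp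
  have X: "L2_order M \<rho> (\<lambda>\<epsilon> \<omega>. (1 / real (N \<epsilon>)) * (\<Sum>n=1..N \<epsilon>. X (?t \<epsilon> n) \<omega> $ i) - \<mu> $ i)"
  proof (rule deviation_L2_order[where k = k and \<kappa> = "\<lambda>_. 0" and w = 0 and b = b])
    fix \<epsilon> :: real and n :: nat assume \<epsilon>: "0 < \<epsilon>"
    show "(\<lambda>\<omega>. X (?t \<epsilon> n) \<omega> $ i) \<in> low_order_products X {?t \<epsilon> n .. real (n + k \<epsilon> + 0) * \<Delta> \<epsilon>}"
      unfolding low_order_products_def by auto
    show "expectation (\<lambda>\<omega>. X (?t \<epsilon> n) \<omega> $ i) = \<mu> $ i" by (rule expectation_X[OF t[OF \<epsilon>]])
    show "moment_le M 2 (\<lambda>\<omega>. X (?t \<epsilon> n) \<omega> $ i) b" by (intro moment_le_4_2 b t \<epsilon>)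
  qed simp
  have YX: "L2_order M \<rho> (\<lambda>\<epsilon> \<omega>. (1 / real (N \<epsilon>)) * (\<Sum>n=1..N \<epsilon>. Y \<epsilon> (?t \<epsilon> n) \<omega> $ i - X (?t \<epsilon> n) \<omega> $ i))"
  proof (rule L2_orderI[where C = 1])
    fix \<epsilon> :: real assume "0 < \<epsilon>"
    then show "moment_le M 2 (\<lambda>\<omega>. (1 / real (N \<epsilon>)) *
        (\<Sum>n=1..N \<epsilon>. Y \<epsilon> (?t \<epsilon> n) \<omega> $ i - X (?t \<epsilon> n) \<omega> $ i)) (1 * \<rho> \<epsilon>)"
      unfolding mult_1 by (intro moment_le_average moment_le_4_2 moment_le_error scheme_pos rho_pos t)
  qed simp
  have "(\<lambda>\<epsilon> \<omega>. emp_mean (N \<epsilon>) (\<Delta> \<epsilon>) (k \<epsilon>) (\<lambda>t. Y \<epsilon> t \<omega>) $ i - \<mu> $ i) =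
    (\<lambda>\<epsilon> \<omega>. (1 / real (N \<epsilon>)) * (\<Sum>n=1..N \<epsilon>. Y \<epsilon> (?t \<epsilon> n) \<omega> $ i - X (?t \<epsilon> n) \<omega> $ i) +
       ((1 / real (N \<epsilon>)) * (\<Sum>n=1..N \<epsilon>. X (?t \<epsilon> n) \<omega> $ i) - \<mu> $ i))"
    by (simp add: emp_mean_def fun_eq_iff sum_subtractf diff_divide_distrib)
  then show ?thesis using L2_order_add[OF YX X rho_pos] by simp
qed

lemma lag_steps_error:
  assumes "0 < d" "0 \<le> u"
  shows "\<bar>real (lag_steps d u) * d - u\<bar> \<le> d"
proof -
  \<comment> \<open>Without this the conversion to natural numbers could cut a negative value off to
    0.\<close>
  have "0 \<le> round (u / d)" using assms by (simp add: round_def add_nonneg_nonneg)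
  then have "real (lag_steps d u) = of_int (round (u / d))" by (simp add: lag_steps_def)
  then have "\<bar>real (lag_steps d u) - u / d\<bar> \<le> 1"
    using of_int_round_abs_le[of "u / d"] by linarith
  then have "\<bar>real (lag_steps d u) - u / d\<bar> * d \<le> 1 * d" using assms by (intro mult_right_mono) auto
  moreover have "real (lag_steps d u) * d - u = (real (lag_steps d u) - u / d) * d"
    using assms by (simp add: algebra_simps)
  ultimately show ?thesis using assms by (simp add: abs_mult)
qed

text \<open>Rounding moves the lag by at most \<Delta>, which eventually lies inside the
  neighbourhood where the covariance is Lipschitz. The bias is deterministic, but is put in the form
  of a random error so that it can be added to the others.\<close>

lemma lag_bias_L2_order:
  assumes u: "0 \<le> u"
  shows "L2_order M \<rho> (\<lambda>\<epsilon> \<omega>. lagged_cov M X (real (lag_steps (\<Delta> \<epsilon>) u) * \<Delta> \<epsilon>) $ i $ j - lagged_cov M X u $ i $ j)"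
proof -
  obtain C where C: "0 < C" "\<forall>\<^sub>F \<epsilon> in at_right 0. 0 < \<epsilon> \<and> 1 / (real (N \<epsilon>) * \<Delta> \<epsilon>) \<le> C * (\<rho> \<epsilon>)\<^sup>2 \<and>
      \<Delta> \<epsilon> \<le> C * \<rho> \<epsilon>" and \<Delta>0: "(\<Delta> \<longlongrightarrow> 0) (at_right 0)"
    using subsampling_scheme_bounds[OF scheme rho_pos rho_tendsto] .
  obtain \<delta> L where L: "0 < \<delta>" "L-lipschitz_on (cball u \<delta> \<inter> {0..}) (lagged_cov M X)"
    using cov_Lipschitz[OF u] by auto
  have L0: "0 \<le> L" by (rule lipschitz_on_nonneg[OF L(2)])
  have "\<forall>\<^sub>F \<epsilon> in at_right 0. \<Delta> \<epsilon> < \<delta>" using order_tendstoD(2)[OF \<Delta>0 L(1)] .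
  then have "\<forall>\<^sub>F \<epsilon> in at_right 0. moment_le M 2 (\<lambda>\<omega>. lagged_cov M X (real (lag_steps (\<Delta> \<epsilon>) u) * \<Delta> \<epsilon>) $ i $ j
      - lagged_cov M X u $ i $ j) ((L * C + 1) * \<rho> \<epsilon>)"
    using C(2)
  proof eventually_elim
    case (elim \<epsilon>)
    then have pos: "0 < \<rho> \<epsilon>" "0 < \<Delta> \<epsilon>" using rho_pos scheme_pos by auto
    let ?v = "real (lag_steps (\<Delta> \<epsilon>) u) * \<Delta> \<epsilon>"
    have v: "\<bar>?v - u\<bar> \<le> \<Delta> \<epsilon>" by (rule lag_steps_error[OF pos(2) u])
    have "\<bar>lagged_cov M X ?v $ i $ j - lagged_cov M X u $ i $ j\<bar> = \<bar>(lagged_cov M X ?v - lagged_cov M X u) $ i $ j\<bar>"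
      by simp
    also have "\<dots> \<le> norm (lagged_cov M X ?v - lagged_cov M X u)"
      by (meson Finite_Cartesian_Product.norm_nth_le order_trans real_norm_def[symmetric] component_le_norm_cart)
    also have "\<dots> \<le> L * norm (?v - u)"
      using v elim u L(1) pos by (intro lipschitz_on_normD[OF L(2)]) (auto simp: dist_real_def)
    also have "\<dots> \<le> L * (C * \<rho> \<epsilon>)" using v elim L0 by (intro mult_left_mono) auto
    also have "\<dots> \<le> (L * C + 1) * \<rho> \<epsilon>" using pos by (simp add: algebra_simps)
    finally show ?case by (rule moment_le_const)
  qed
  then show ?thesis unfolding L2_order_def using L0 C(1)
    by (intro exI[of _ "L * C + 1"]) (auto simp: add_nonneg_pos)
qed

text \<open>Three errors add up: replacing Y by X in the products, the fluctuation of the X products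
  about their mean at the rounded lag, and the bias from rounding. For the first, the difference of
  products telescopes into (Y_s - X_s) Y_t + X_s (Y_t - X_t).\<close>

lemma emp_product_L2_order:
  assumes u: "0 \<le> u"
  shows "L2_order M \<rho> (\<lambda>\<epsilon> \<omega>. (1 / real (N \<epsilon>)) * (\<Sum>n=1..N \<epsilon>.
      Y \<epsilon> (real n * \<Delta> \<epsilon>) \<omega> $ i * Y \<epsilon> (real (n + lag_steps (\<Delta> \<epsilon>) u) * \<Delta> \<epsilon>) \<omega> $ j)
      - (lagged_cov M X u $ i $ j + \<mu> $ i * \<mu> $ j))"
proof -
  obtain b where b: "0 < b" "\<And>t i. 0 \<le> t \<Longrightarrow> moment_le M 4 (\<lambda>\<omega>. X t \<omega> $ i) b"
    "\<And>\<epsilon> t i. 0 < \<epsilon> \<Longrightarrow> 0 \<le> t \<Longrightarrow> moment_le M 4 (\<lambda>\<omega>. Y \<epsilon> t \<omega> $ i) b"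
    using uniform_moment_bound by metis
  let ?\<kappa> = "\<lambda>\<epsilon>. lag_steps (\<Delta> \<epsilon>) u"
  let ?s = "\<lambda>\<epsilon> n. real n * \<Delta> \<epsilon>" and ?t = "\<lambda>\<epsilon> n. real (n + ?\<kappa> \<epsilon>) * \<Delta> \<epsilon>"
  let ?m = "\<lambda>\<epsilon>. lagged_cov M X (real (?\<kappa> \<epsilon>) * \<Delta> \<epsilon>) $ i $ j + \<mu> $ i * \<mu> $ j"
  have st: "0 \<le> ?s \<epsilon> n" "0 \<le> ?t \<epsilon> n" if "0 < \<epsilon>" for \<epsilon> n using scheme_pos[OF that] by auto
  have t_eq: "?t \<epsilon> n = ?s \<epsilon> n + real (?\<kappa> \<epsilon>) * \<Delta> \<epsilon>" for \<epsilon> n by (simp add: algebra_simps)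
  have X: "L2_order M \<rho> (\<lambda>\<epsilon> \<omega>. (1 / real (N \<epsilon>)) * (\<Sum>n=1..N \<epsilon>. X (?s \<epsilon> n) \<omega> $ i * X (?t \<epsilon> n) \<omega> $ j) - ?m \<epsilon>)"
  \<comment> \<open>The window is the rounded lag, eventually within \<Delta> < 1 of
    \<open>u\<close>, hence at most u + 1; fourth moments bounded by \<open>b\<close> give the
    products second moments bounded by b * b.\<close>
  proof (rule deviation_L2_order[where k = "\<lambda>_. 0" and \<kappa> = ?\<kappa> and w = "u + 1" and b = "b * b"])
    fix \<epsilon> :: real and n :: nat assume \<epsilon>: "0 < \<epsilon>"
    have "?s \<epsilon> n \<le> ?t \<epsilon> n" using scheme_pos[OF \<epsilon>] by (intro mult_right_mono) auto
    then have "?s \<epsilon> n \<in> {?s \<epsilon> n..?t \<epsilon> n}" "?t \<epsilon> n \<in> {?s \<epsilon> n..?t \<epsilon> n}" by auto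
    then have "(\<lambda>\<omega>. X (?s \<epsilon> n) \<omega> $ i * X (?t \<epsilon> n) \<omega> $ j) \<in> low_order_products X {?s \<epsilon> n..?t \<epsilon> n}"
      unfolding low_order_products_def by blast
    then show "(\<lambda>\<omega>. X (?s \<epsilon> n) \<omega> $ i * X (?t \<epsilon> n) \<omega> $ j) \<in>
        low_order_products X {real (n + 0) * \<Delta> \<epsilon> .. real (n + 0 + ?\<kappa> \<epsilon>) * \<Delta> \<epsilon>}" by simp
    show "expectation (\<lambda>\<omega>. X (?s \<epsilon> n) \<omega> $ i * X (?t \<epsilon> n) \<omega> $ j) = ?m \<epsilon>"
      unfolding t_eq using scheme_pos[OF \<epsilon>] by (intro expectation_X_product) auto
    show "moment_le M 2 (\<lambda>\<omega>. X (?s \<epsilon> n) \<omega> $ i * X (?t \<epsilon> n) \<omega> $ j) (b * b)"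
      by (intro moment_le_mult b st \<epsilon>)
  next
    have "(\<Delta> \<longlongrightarrow> 0) (at_right 0)"
      by (rule subsampling_scheme_bounds[OF scheme rho_pos rho_tendsto])
    from order_tendstoD(2)[OF this, of 1] eventually_at_right_less[of "0::real"]
    show "\<forall>\<^sub>F \<epsilon> in at_right 0. real (?\<kappa> \<epsilon>) * \<Delta> \<epsilon> \<le> u + 1"
    proof (rule eventually_elim2)
      fix \<epsilon> :: real assume "\<Delta> \<epsilon> < 1" "0 < \<epsilon>"
      then show "real (?\<kappa> \<epsilon>) * \<Delta> \<epsilon> \<le> u + 1"
        using lag_steps_error[OF scheme_pos(2) u, of \<epsilon>] by auto
    qed simp
  qed
  have YX: "L2_order M \<rho> (\<lambda>\<epsilon> \<omega>. (1 / real (N \<epsilon>)) * (\<Sum>n=1..N \<epsilon>.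
      (Y \<epsilon> (?s \<epsilon> n) \<omega> $ i - X (?s \<epsilon> n) \<omega> $ i) * Y \<epsilon> (?t \<epsilon> n) \<omega> $ j +
      X (?s \<epsilon> n) \<omega> $ i * (Y \<epsilon> (?t \<epsilon> n) \<omega> $ j - X (?t \<epsilon> n) \<omega> $ j)))"
  proof (rule L2_orderI[where C = "2 * b"])
    fix \<epsilon> :: real assume \<epsilon>: "0 < \<epsilon>"
    note pos = scheme_pos[OF \<epsilon>] rho_pos[OF \<epsilon>]
    \<comment> \<open>Each telescoped product pairs a factor of L^4 size \<rho> with one of L^4 size
      \<open>b\<close>; the bound is rewritten to match this sum.\<close>
    have "2 * b * \<rho> \<epsilon> = \<rho> \<epsilon> * b + b * \<rho> \<epsilon>" by simp
    then show "moment_le M 2 (\<lambda>\<omega>. (1 / real (N \<epsilon>)) * (\<Sum>n=1..N \<epsilon>.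
      (Y \<epsilon> (?s \<epsilon> n) \<omega> $ i - X (?s \<epsilon> n) \<omega> $ i) * Y \<epsilon> (?t \<epsilon> n) \<omega> $ j +
      X (?s \<epsilon> n) \<omega> $ i * (Y \<epsilon> (?t \<epsilon> n) \<omega> $ j - X (?t \<epsilon> n) \<omega> $ j))) (2 * b * \<rho> \<epsilon>)"
      using pos b(1) by (simp only:)
        (intro moment_le_average moment_le_add moment_le_mult moment_le_error b st \<epsilon> mult_pos_pos)
  qed (use b in simp)
  have "(\<lambda>\<epsilon> \<omega>. (1 / real (N \<epsilon>)) * (\<Sum>n=1..N \<epsilon>. Y \<epsilon> (?s \<epsilon> n) \<omega> $ i * Y \<epsilon> (?t \<epsilon> n) \<omega> $ j)
      - (lagged_cov M X u $ i $ j + \<mu> $ i * \<mu> $ j)) =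
    (\<lambda>\<epsilon> \<omega>. ((1 / real (N \<epsilon>)) * (\<Sum>n=1..N \<epsilon>.
      (Y \<epsilon> (?s \<epsilon> n) \<omega> $ i - X (?s \<epsilon> n) \<omega> $ i) * Y \<epsilon> (?t \<epsilon> n) \<omega> $ j +
      X (?s \<epsilon> n) \<omega> $ i * (Y \<epsilon> (?t \<epsilon> n) \<omega> $ j - X (?t \<epsilon> n) \<omega> $ j))
     + ((1 / real (N \<epsilon>)) * (\<Sum>n=1..N \<epsilon>. X (?s \<epsilon> n) \<omega> $ i * X (?t \<epsilon> n) \<omega> $ j) - ?m \<epsilon>))
     + (lagged_cov M X (real (?\<kappa> \<epsilon>) * \<Delta> \<epsilon>) $ i $ j - lagged_cov M X u $ i $ j))"
    (is "_ = (\<lambda>\<epsilon> \<omega>. (_ * (\<Sum>n=1..N \<epsilon>. ?P \<epsilon> \<omega> n) + (_ * (\<Sum>n=1..N \<epsilon>. ?Q \<epsilon> \<omega> n) - _)) + _)")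
  proof (intro ext)
    fix \<epsilon> \<omega>
    have "(\<Sum>n=1..N \<epsilon>. Y \<epsilon> (?s \<epsilon> n) \<omega> $ i * Y \<epsilon> (?t \<epsilon> n) \<omega> $ j) =
      (\<Sum>n=1..N \<epsilon>. ?P \<epsilon> \<omega> n) + (\<Sum>n=1..N \<epsilon>. ?Q \<epsilon> \<omega> n)"
      unfolding sum.distrib[symmetric] by (intro sum.cong refl) (simp add: algebra_simps)
    then show "(1 / real (N \<epsilon>)) * (\<Sum>n=1..N \<epsilon>. Y \<epsilon> (?s \<epsilon> n) \<omega> $ i * Y \<epsilon> (?t \<epsilon> n) \<omega> $ j)
      - (lagged_cov M X u $ i $ j + \<mu> $ i * \<mu> $ j) = ((1 / real (N \<epsilon>)) * (\<Sum>n=1..N \<epsilon>. ?P \<epsilon> \<omega> n) +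
     ((1 / real (N \<epsilon>)) * (\<Sum>n=1..N \<epsilon>. ?Q \<epsilon> \<omega> n) - ?m \<epsilon>))
     + (lagged_cov M X (real (?\<kappa> \<epsilon>) * \<Delta> \<epsilon>) $ i $ j - lagged_cov M X u $ i $ j)"
      by (simp only: distrib_left)
  qed
  then show ?thesis
    using L2_order_add[OF L2_order_add[OF YX X rho_pos] lag_bias_L2_order[OF u, of i j] rho_pos] by simp
qed

text \<open>For a covariance, writing the two empirical means as \<mu>_i + A and \<mu>_j + B turns
  the error into P - \<mu>_i B - \<mu>_j A - A B. All terms but A B are of order \<rho> in L^2; A B
  is what forces the truncated order.\<close>

lemma emp_moment_truncated_L2_order:
  assumes "valid_lag \<psi>"
  shows "truncated_L2_order M \<rho>
    (\<lambda>\<epsilon> \<omega>. emp_moment (N \<epsilon>) (\<Delta> \<epsilon>) (\<lambda>t. Y \<epsilon> t \<omega>) \<psi> - moment_value M X \<psi>)"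
proof (cases \<psi>)
  case (Mean i)
  show ?thesis unfolding Mean emp_moment.simps moment_value.simps
    by (intro truncated_L2_order_L2 emp_mean_L2_order)
next
  case (Cov i j u)
  then have u: "0 \<le> u" using assms by simp
  let ?A = "\<lambda>\<epsilon> \<omega>. emp_mean (N \<epsilon>) (\<Delta> \<epsilon>) 0 (\<lambda>t. Y \<epsilon> t \<omega>) $ i - \<mu> $ i"
  let ?B = "\<lambda>\<epsilon> \<omega>. emp_mean (N \<epsilon>) (\<Delta> \<epsilon>) (lag_steps (\<Delta> \<epsilon>) u) (\<lambda>t. Y \<epsilon> t \<omega>) $ j - \<mu> $ j"
  let ?P = "\<lambda>\<epsilon> \<omega>. (1 / real (N \<epsilon>)) * (\<Sum>n=1..N \<epsilon>.
      Y \<epsilon> (real n * \<Delta> \<epsilon>) \<omega> $ i * Y \<epsilon> (real (n + lag_steps (\<Delta> \<epsilon>) u) * \<Delta> \<epsilon>) \<omega> $ j)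
      - (lagged_cov M X u $ i $ j + \<mu> $ i * \<mu> $ j)"
  have A: "L2_order M \<rho> ?A" and B: "L2_order M \<rho> ?B" by (rule emp_mean_L2_order)+
  have L2: "L2_order M \<rho> (\<lambda>\<epsilon> \<omega>. ?P \<epsilon> \<omega> + ((- \<mu> $ i) * ?B \<epsilon> \<omega> + (- \<mu> $ j) * ?A \<epsilon> \<omega>))"
    by (intro L2_order_add L2_order_cmult A B emp_product_L2_order u rho_pos)
  have AB: "truncated_L2_order M \<rho> (\<lambda>\<epsilon> \<omega>. (- 1 * ?A \<epsilon> \<omega>) * ?B \<epsilon> \<omega>)"
    by (intro truncated_L2_order_mult L2_order_cmult A B rho_pos)
  have "(\<lambda>\<epsilon> \<omega>. emp_moment (N \<epsilon>) (\<Delta> \<epsilon>) (\<lambda>t. Y \<epsilon> t \<omega>) \<psi> - moment_value M X \<psi>) =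
    (\<lambda>\<epsilon> \<omega>. (?P \<epsilon> \<omega> + ((- \<mu> $ i) * ?B \<epsilon> \<omega> + (- \<mu> $ j) * ?A \<epsilon> \<omega>)) + (- 1 * ?A \<epsilon> \<omega>) * ?B \<epsilon> \<omega>)"
    by (intro ext) (simp add: Cov emp_cov_def Let_def outer_def algebra_simps)
  then show ?thesis
    using truncated_L2_order_add[OF truncated_L2_order_L2[OF L2] AB] by simp
qed

end

subsection \<open>Plug-in estimators\<close>

lemma min_1_sum_le:
  fixes a :: "'i \<Rightarrow> real"
  assumes "finite I" "\<And>i. i \<in> I \<Longrightarrow> 0 \<le> a i"
  shows "min 1 (\<Sum>i\<in>I. a i) \<le> (\<Sum>i\<in>I. min 1 (a i))"
  using assms
proof (induction I rule: finite_induct)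
  case (insert i I)
  then have "min 1 (\<Sum>i\<in>I. a i) \<le> (\<Sum>i\<in>I. min 1 (a i))" "0 \<le> a i" "0 \<le> (\<Sum>i\<in>I. a i)"
    by (auto intro: sum_nonneg)
  then show ?case using insert(1,2) by (simp add: min_def split: if_splits)
qed simp

text \<open>The squared Euclidean norm is a finite sum of squares and \<open>min 1\<close> is
  subadditive on nonnegative numbers, so the coordinate constants add up.\<close>

lemma (in prob_space) truncated_L2_order_norm:
  fixes Z :: "real \<Rightarrow> 'a \<Rightarrow> real ^ 'n"
  assumes "\<And>j. truncated_L2_order M \<rho> (\<lambda>\<epsilon> \<omega>. Z \<epsilon> \<omega> $ j)"
    and Z: "\<And>\<epsilon>. 0 < \<epsilon> \<Longrightarrow> Z \<epsilon> \<in> borel_measurable M"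
  shows "truncated_L2_order M \<rho> (\<lambda>\<epsilon> \<omega>. norm (Z \<epsilon> \<omega>))"
proof -
  have "\<forall>j. \<exists>C. \<forall>\<^sub>F \<epsilon> in at_right 0. (\<lambda>\<omega>. Z \<epsilon> \<omega> $ j) \<in> borel_measurable M \<and>
      expectation (\<lambda>\<omega>. min 1 ((Z \<epsilon> \<omega> $ j)\<^sup>2)) \<le> C * (\<rho> \<epsilon>)\<^sup>2"
    using assms(1) unfolding truncated_L2_order_def by (rule allI)
  from choice[OF this] obtain C where "\<forall>j. \<forall>\<^sub>F \<epsilon> in at_right 0. (\<lambda>\<omega>. Z \<epsilon> \<omega> $ j) \<in> borel_measurable M \<and>
      expectation (\<lambda>\<omega>. min 1 ((Z \<epsilon> \<omega> $ j)\<^sup>2)) \<le> C j * (\<rho> \<epsilon>)\<^sup>2" ..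
  then have "\<forall>\<^sub>F \<epsilon> in at_right 0. \<forall>j. (\<lambda>\<omega>. Z \<epsilon> \<omega> $ j) \<in> borel_measurable M \<and>
      expectation (\<lambda>\<omega>. min 1 ((Z \<epsilon> \<omega> $ j)\<^sup>2)) \<le> C j * (\<rho> \<epsilon>)\<^sup>2"
    by (intro eventually_all_finite) (rule spec)
  then have "\<forall>\<^sub>F \<epsilon> in at_right 0. (\<lambda>\<omega>. norm (Z \<epsilon> \<omega>)) \<in> borel_measurable M \<and>
      expectation (\<lambda>\<omega>. min 1 ((norm (Z \<epsilon> \<omega>))\<^sup>2)) \<le> (\<Sum>j\<in>UNIV. C j) * (\<rho> \<epsilon>)\<^sup>2"
    using eventually_at_right_less[of "0::real"]
  proof eventually_elim
    case (elim \<epsilon>)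
    note [measurable] = Z[OF elim(2)]
    have sq: "(norm (Z \<epsilon> \<omega>))\<^sup>2 = (\<Sum>j\<in>UNIV. (Z \<epsilon> \<omega> $ j)\<^sup>2)" for \<omega>
      unfolding power2_norm_eq_inner inner_vec_def by (simp add: power2_eq_square)
    have int: "integrable M (\<lambda>\<omega>. min 1 ((Z \<epsilon> \<omega> $ j)\<^sup>2))" for j
      by (rule integrable_min_1) simp_all
    have "expectation (\<lambda>\<omega>. min 1 ((norm (Z \<epsilon> \<omega>))\<^sup>2)) \<le> expectation (\<lambda>\<omega>. \<Sum>j\<in>UNIV. min 1 ((Z \<epsilon> \<omega> $ j)\<^sup>2))"
    proof (rule integral_mono)
      show "integrable M (\<lambda>\<omega>. min 1 ((norm (Z \<epsilon> \<omega>))\<^sup>2))" by (rule integrable_min_1) simp_all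
      show "integrable M (\<lambda>\<omega>. \<Sum>j\<in>UNIV. min 1 ((Z \<epsilon> \<omega> $ j)\<^sup>2))"
        by (intro Bochner_Integration.integrable_sum int)
      show "min 1 ((norm (Z \<epsilon> \<omega>))\<^sup>2) \<le> (\<Sum>j\<in>UNIV. min 1 ((Z \<epsilon> \<omega> $ j)\<^sup>2))" for \<omega>
        unfolding sq by (rule min_1_sum_le) auto
    qed
    also have "\<dots> = (\<Sum>j\<in>UNIV. expectation (\<lambda>\<omega>. min 1 ((Z \<epsilon> \<omega> $ j)\<^sup>2)))"
      by (intro Bochner_Integration.integral_sum int)
    also have "\<dots> \<le> (\<Sum>j\<in>UNIV. C j * (\<rho> \<epsilon>)\<^sup>2)" using elim(1) by (intro sum_mono) blast
    finally show ?case by (simp add: sum_distrib_right)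
  qed
  then show ?thesis unfolding truncated_L2_order_def by blast
qed

lemma borel_measurable_infnorm [measurable]:
  "(infnorm :: 'v::euclidean_space \<Rightarrow> real) \<in> borel_measurable borel"
  by (intro borel_measurable_continuous_onI continuous_intros)

text \<open>Markov's inequality for min 1 |D - m|^2: by continuity of \<open>G\<close> at
  \<open>m\<close>, a deviation above \<delta> forces |D - m| to exceed a fixed radius.\<close>

lemma (in prob_space) plug_in_consistent:
  fixes D :: "real \<Rightarrow> 'a \<Rightarrow> 'v::euclidean_space" and G :: "'v \<Rightarrow> 'w::euclidean_space"
  assumes D: "\<And>\<epsilon>. 0 < \<epsilon> \<Longrightarrow> D \<epsilon> \<in> borel_measurable M"
    and order: "truncated_L2_order M \<rho> (\<lambda>\<epsilon> \<omega>. norm (D \<epsilon> \<omega> - m))"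
    and [measurable]: "G \<in> borel_measurable borel" and cont: "isCont G m"
    and lim: "(\<rho> \<longlongrightarrow> 0) (at_right 0)" and "0 < \<delta>"
  shows "((\<lambda>\<epsilon>. prob {\<omega> \<in> space M. \<delta> < infnorm (G (D \<epsilon> \<omega>) - G m)}) \<longlongrightarrow> 0) (at_right 0)"
proof -
  obtain C where C: "\<forall>\<^sub>F \<epsilon> in at_right 0. (\<lambda>\<omega>. norm (D \<epsilon> \<omega> - m)) \<in> borel_measurable M \<and>
     expectation (\<lambda>\<omega>. min 1 ((norm (D \<epsilon> \<omega> - m))\<^sup>2)) \<le> C * (\<rho> \<epsilon>)\<^sup>2"
    using order by (auto simp: truncated_L2_order_def)
  obtain r0 where r0: "0 < r0" "\<And>x. dist x m < r0 \<Longrightarrow> dist (G x) (G m) < \<delta>"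
    using cont \<open>0 < \<delta>\<close> unfolding continuous_at_eps_delta by metis
  \<comment> \<open>The cap at 1 ensures that |D - m| >= r still implies min 1 |D - m|^2 >=
    r^2.\<close>
  define r where "r = min 1 r0"
  have r: "0 < r" "r \<le> 1" "\<And>x. norm (x - m) < r \<Longrightarrow> infnorm (G x - G m) < \<delta>"
    using r0 by (auto simp: r_def dist_norm intro: le_less_trans[OF infnorm_le_norm])
  have le: "\<forall>\<^sub>F \<epsilon> in at_right 0. prob {\<omega> \<in> space M. \<delta> < infnorm (G (D \<epsilon> \<omega>) - G m)} \<le> (C / r\<^sup>2) * (\<rho> \<epsilon>)\<^sup>2"
    using C eventually_at_right_less[of "0::real"]
  proof eventually_elim
    case (elim \<epsilon>)
    note [measurable] = D[OF elim(2)]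
    let ?A = "{\<omega> \<in> space M. \<delta> < infnorm (G (D \<epsilon> \<omega>) - G m)}"
    have A [measurable]: "?A \<in> sets M" by measurable
    have int: "integrable M (\<lambda>\<omega>. min 1 ((norm (D \<epsilon> \<omega> - m))\<^sup>2))" by (rule integrable_min_1) simp_all
    have "prob ?A = expectation (indicator ?A)" by simp
    also have "\<dots> \<le> expectation (\<lambda>\<omega>. min 1 ((norm (D \<epsilon> \<omega> - m))\<^sup>2) / r\<^sup>2)"
    proof (rule integral_mono)
      show "indicator ?A \<omega> \<le> min 1 ((norm (D \<epsilon> \<omega> - m))\<^sup>2) / r\<^sup>2" for \<omega>
      proof (cases "\<omega> \<in> ?A")
        case True
        then have "r \<le> norm (D \<epsilon> \<omega> - m)" using r(3)[of "D \<epsilon> \<omega>"] by fastforce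
        then have "r\<^sup>2 \<le> (norm (D \<epsilon> \<omega> - m))\<^sup>2" using r(1) by (intro power_mono) auto
        moreover have "r\<^sup>2 \<le> 1" using r by (simp add: power_le_one)
        ultimately show ?thesis using True r(1) by (simp add: pos_le_divide_eq)
      qed simp
      show "integrable M (indicator ?A :: 'a \<Rightarrow> real)"
        by (rule integrable_real_indicator[OF A]) (simp add: emeasure_eq_measure)
      show "integrable M (\<lambda>\<omega>. min 1 ((norm (D \<epsilon> \<omega> - m))\<^sup>2) / r\<^sup>2)"
        by (intro integrable_divide int)
    qed
    also have "\<dots> \<le> C * (\<rho> \<epsilon>)\<^sup>2 / r\<^sup>2" using elim by (simp add: divide_right_mono)
    finally show ?case by simp
  qed
  show ?thesis
  proof (rule tendsto_sandwich[OF _ le tendsto_const])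
    show "((\<lambda>\<epsilon>. (C / r\<^sup>2) * (\<rho> \<epsilon>)\<^sup>2) \<longlongrightarrow> 0) (at_right 0)"
      using tendsto_mult[OF tendsto_const tendsto_power[OF lim, of 2], of "C / r\<^sup>2"] by simp
  qed simp
qed

text \<open>The constant is a bound for the derivative at \<open>m\<close> plus 1 for the remainder,
  taken from the definition of the derivative with tolerance 1. Only increments starting at
  \<open>m\<close> are controlled, which is all that plugging in requires.\<close>

lemma differentiable_local_Lipschitz:
  fixes G :: "'v::real_normed_vector \<Rightarrow> 'w::real_normed_vector"
  assumes "G differentiable (at m)"
  obtains r L where "0 < r" "0 < L" "\<And>x. norm (x - m) < r \<Longrightarrow> norm (G x - G m) \<le> L * norm (x - m)"
proof -
  obtain G' where G': "(G has_derivative G') (at m)" using assms by (auto simp: differentiable_def)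
  then obtain r where r: "0 < r" "\<And>x. norm (x - m) < r \<Longrightarrow> norm (G x - G m - G' (x - m)) \<le> 1 * norm (x - m)"
    unfolding has_derivative_at_alt by (meson zero_less_one)
  obtain K where K: "0 < K" "\<And>x. norm (G' x) \<le> norm x * K"
    using bounded_linear.pos_bounded[OF has_derivative_bounded_linear[OF G']] by blast
  have "norm (G x - G m) \<le> (K + 1) * norm (x - m)" if "norm (x - m) < r" for x
    using r(2)[OF that] K(2)[of "x - m"] norm_triangle_ineq2[of "G x - G m" "G' (x - m)"]
    by (simp add: algebra_simps)
  then show ?thesis using r(1) K(1) by (intro that[of r "K + 1"]) auto
qed

text \<open>As \<open>G m\<close> is interior to \<open>\<Lambda>\<close>, the truncation is inactive while \<open>D\<close> is close to \<open>m\<close>, and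
  elsewhere the error is bounded; so the error is dominated by \<open>min 1 \<parallel>D - m\<parallel>\<close> up to a constant.\<close>

lemma (in prob_space) plug_in_truncated_rate:
  fixes D :: "real \<Rightarrow> 'a \<Rightarrow> 'v::euclidean_space" and G :: "'v \<Rightarrow> real ^ 'n"
  assumes D: "\<And>\<epsilon>. 0 < \<epsilon> \<Longrightarrow> D \<epsilon> \<in> borel_measurable M"
    and order: "truncated_L2_order M \<rho> (\<lambda>\<epsilon> \<omega>. norm (D \<epsilon> \<omega> - m))"
    and G [measurable]: "G \<in> borel_measurable borel" and diff: "G differentiable (at m)"
    and rho_pos: "\<And>\<epsilon>. 0 < \<epsilon> \<Longrightarrow> 0 < \<rho> \<epsilon>"
    and \<Lambda> [measurable]: "\<Lambda> \<in> sets borel" and bounded: "bounded \<Lambda>" and interior: "G m \<in> interior \<Lambda>"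
  shows "\<exists>C. \<forall>\<^sub>F \<epsilon> in at_right 0.
    Lp_norm_le M 2 (\<lambda>\<omega>. indicator \<Lambda> (G (D \<epsilon> \<omega>)) *\<^sub>R G (D \<epsilon> \<omega>) - G m) (C * \<rho> \<epsilon>)"
proof -
  obtain C where C: "\<forall>\<^sub>F \<epsilon> in at_right 0. (\<lambda>\<omega>. norm (D \<epsilon> \<omega> - m)) \<in> borel_measurable M \<and>
     expectation (\<lambda>\<omega>. min 1 ((norm (D \<epsilon> \<omega> - m))\<^sup>2)) \<le> C * (\<rho> \<epsilon>)\<^sup>2"
    using order by (auto simp: truncated_L2_order_def)
  define T where "T x = indicator \<Lambda> (G x) *\<^sub>R G x - G m" for x
  have T_meas [measurable]: "T \<in> borel_measurable borel" unfolding T_def by measurable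
  obtain r0 L where L: "0 < r0" "0 < L" "\<And>x. norm (x - m) < r0 \<Longrightarrow> norm (G x - G m) \<le> L * norm (x - m)"
    using differentiable_local_Lipschitz[OF diff] by metis
  obtain \<eta> where \<eta>: "0 < \<eta>" "ball (G m) \<eta> \<subseteq> \<Lambda>"
    using interior by (auto simp: mem_interior)
  obtain R where R: "0 < R" "\<And>x. x \<in> \<Lambda> \<Longrightarrow> norm x \<le> R" using bounded by (auto simp: bounded_pos)
  have Gm: "norm (G m) \<le> R" using R(2) interior interior_subset by blast
  \<comment> \<open>Within this radius the minimum with 1 is inactive, the Lipschitz bound holds,
    and \<open>G x\<close> stays in the ball of radius \<eta> inside \<Lambda>.\<close>
  define r where "r = min (min 1 r0) (\<eta> / L)"
  have r: "0 < r" "r \<le> 1" "r \<le> r0" "r * L \<le> \<eta>"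
    using L \<eta> by (auto simp: r_def simp flip: pos_le_divide_eq)
  \<comment> \<open>The first summand serves points near \<open>m\<close>. The second serves the
    others: there the error is at most 2 R, a bound R for each of its two terms, while the minimum
    is at least r^2.\<close>
  define K where "K = L\<^sup>2 + (2 * R)\<^sup>2 / r\<^sup>2"
  have K: "L\<^sup>2 \<le> K" "(2 * R)\<^sup>2 \<le> K * r\<^sup>2" "0 \<le> K" using r(1) by (auto simp: K_def distrib_right)
  have T: "(infnorm (T x))\<^sup>2 \<le> K * min 1 ((norm (x - m))\<^sup>2)" for x
  proof (cases "norm (x - m) < r")
    case True
    then have "norm (G x - G m) \<le> L * norm (x - m)" using L(3) r by simp
    moreover have "L * norm (x - m) < r * L" using True L(2) by simp
    ultimately have "G x \<in> ball (G m) \<eta>" using r(4) by (simp add: dist_norm norm_minus_commute)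
    then have "T x = G x - G m" using \<eta>(2) by (auto simp: T_def)
    then have "infnorm (T x) \<le> L * norm (x - m)"
      using infnorm_le_norm[of "T x"] \<open>norm (G x - G m) \<le> L * norm (x - m)\<close> by simp
    then have "(infnorm (T x))\<^sup>2 \<le> (L * norm (x - m))\<^sup>2"
      by (intro power_mono infnorm_pos_le)
    also have "\<dots> \<le> K * (norm (x - m))\<^sup>2"
      unfolding power_mult_distrib by (intro mult_right_mono K) simp
    also have "(norm (x - m))\<^sup>2 \<le> 1" using True r(2) by (intro power_le_one) auto
    then have "(norm (x - m))\<^sup>2 = min 1 ((norm (x - m))\<^sup>2)" by simp
    finally show ?thesis .
  next
    case False
    have "norm (indicator \<Lambda> (G x) *\<^sub>R G x) \<le> R" using R by (auto simp: indicator_def)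
    then have "norm (T x) \<le> 2 * R"
      unfolding T_def using norm_triangle_ineq4[of "indicator \<Lambda> (G x) *\<^sub>R G x" "G m"] Gm by linarith
    then have "infnorm (T x) \<le> 2 * R" using infnorm_le_norm[of "T x"] by linarith
    then have "(infnorm (T x))\<^sup>2 \<le> (2 * R)\<^sup>2" by (intro power_mono infnorm_pos_le)
    also have "\<dots> \<le> K * r\<^sup>2" by (rule K)
    also have "\<dots> \<le> K * min 1 ((norm (x - m))\<^sup>2)"
      using False r K(3) by (intro mult_left_mono) (auto simp: power_le_one intro: power_mono)
    finally show ?thesis .
  qed
  have "\<forall>\<^sub>F \<epsilon> in at_right 0. Lp_norm_le M 2 (\<lambda>\<omega>. T (D \<epsilon> \<omega>)) (sqrt (K * C) * \<rho> \<epsilon>)"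
    using C eventually_at_right_less[of "0::real"]
  proof eventually_elim
    case (elim \<epsilon>)
    note [measurable] = D[OF elim(2)]
    have int: "integrable M (\<lambda>\<omega>. K * min 1 ((norm (D \<epsilon> \<omega> - m))\<^sup>2))"
      by (intro integrable_mult_right integrable_min_1) simp_all
    have intT: "integrable M (\<lambda>\<omega>. (infnorm (T (D \<epsilon> \<omega>)))\<^sup>2)"
      by (rule Bochner_Integration.integrable_bound[OF int]) (use T in \<open>auto intro!: order_trans[OF _ abs_ge_self]\<close>)
    let ?E = "expectation (\<lambda>\<omega>. (infnorm (T (D \<epsilon> \<omega>)))\<^sup>2)"
    have "?E \<le> expectation (\<lambda>\<omega>. K * min 1 ((norm (D \<epsilon> \<omega> - m))\<^sup>2))"
      using T by (intro integral_mono intT int)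
    also have "\<dots> \<le> K * (C * (\<rho> \<epsilon>)\<^sup>2)" using elim K(3) by (simp add: mult_left_mono)
    finally have E: "?E \<le> K * C * (\<rho> \<epsilon>)\<^sup>2" by (simp add: mult.assoc)
    have "0 \<le> ?E" by (intro Bochner_Integration.integral_nonneg) simp
    then have "?E powr (1 / real 2) = sqrt ?E" by (simp add: powr_half_sqrt)
    also have "\<dots> \<le> sqrt (K * C * (\<rho> \<epsilon>)\<^sup>2)" using E by simp
    also have "\<dots> = sqrt (K * C) * \<rho> \<epsilon>" using rho_pos[OF elim(2)] by (simp add: real_sqrt_mult)
    finally show ?case using intT by (simp add: Lp_norm_le_def Lp_norm_def)
  qed
  then show ?thesis unfolding T_def by blast
qed

subsection \<open>Observability\<close>

text \<open>Rounding inverts the passage from step numbers to grid times; this lets a vector of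
  observations be read as a path.\<close>

lemma lag_steps_multiple: "0 < d \<Longrightarrow> lag_steps d (real n * d) = n"
  by (simp add: lag_steps_def)

text \<open>How many grid steps past N the empirical moment reads; it determines how many
  observations are needed.\<close>

primrec moment_shift :: "real \<Rightarrow> 'r lagged_moment \<Rightarrow> nat" where
  "moment_shift d (Mean i) = 0"
| "moment_shift d (Cov i j u) = lag_steps d u"

lemma emp_moment_cong:
  assumes "\<And>n. n \<le> N + moment_shift d \<psi> \<Longrightarrow> y (real n * d) = y' (real n * d)"
  shows "emp_moment N d y \<psi> = emp_moment N d y' \<psi>"
proof (cases \<psi>)
  case (Mean i)
  then show ?thesis using assms by (simp add: emp_mean_def del: of_nat_add)
next
  case (Cov i j u)
  then have eq: "y (real n * d) = y' (real n * d)" if "n \<le> N + lag_steps d u" for n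
    using assms that by simp
  have "emp_mean N d k y = emp_mean N d k y'" if "k \<le> lag_steps d u" for k
    unfolding emp_mean_def using eq that by (intro arg_cong2[of _ _ _ _ scaleR] sum.cong refl) (auto simp del: of_nat_add)
  moreover have "(\<Sum>n=1..N. outer (y (real n * d)) (y (real (n + lag_steps d u) * d))) =
      (\<Sum>n=1..N. outer (y' (real n * d)) (y' (real (n + lag_steps d u) * d)))"
    by (intro sum.cong refl arg_cong2[of _ _ _ _ outer] eq) auto
  ultimately show ?thesis by (simp add: Cov emp_cov_def Let_def del: of_nat_add)
qed

lemma emp_moment_measurable:
  assumes "\<And>n. n \<le> N + moment_shift d \<psi> \<Longrightarrow> (\<lambda>\<omega>. y \<omega> (real n * d)) \<in> borel_measurable M"
  shows "(\<lambda>\<omega>. emp_moment N d (y \<omega>) \<psi>) \<in> borel_measurable M"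
proof (cases \<psi>)
  case (Mean i)
  then show ?thesis using assms
    by (auto simp: emp_mean_def simp del: of_nat_add
        intro!: borel_measurable_sum borel_measurable_divide borel_measurable_vec_nth)
next
  case (Cov i j u)
  then have y: "(\<lambda>\<omega>. y \<omega> (real n * d) $ i) \<in> borel_measurable M" if "n \<le> N + lag_steps d u" for n i
    using assms that by (intro borel_measurable_vec_nth) simp
  have "(\<lambda>\<omega>. emp_mean N d k (y \<omega>) $ i) \<in> borel_measurable M" if "k \<le> lag_steps d u" for k i
    unfolding emp_mean_def vector_scaleR_component sum_component using y that
    by (intro borel_measurable_scaleR borel_measurable_sum) (auto simp del: of_nat_add)
  moreover have "(\<lambda>\<omega>. \<Sum>n=1..N. y \<omega> (real n * d) $ i * y \<omega> (real (n + lag_steps d u) * d) $ j) \<in> borel_measurable M"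
    by (intro borel_measurable_sum borel_measurable_times y) auto
  moreover have "emp_moment N d (y \<omega>) \<psi> =
    (1 / real N) * (\<Sum>n=1..N. y \<omega> (real n * d) $ i * y \<omega> (real (n + lag_steps d u) * d) $ j)
    - emp_mean N d 0 (y \<omega>) $ i * emp_mean N d (lag_steps d u) (y \<omega>) $ j" for \<omega>
    by (simp add: Cov emp_cov_def Let_def outer_def)
  ultimately show ?thesis
    by (auto intro!: borel_measurable_diff borel_measurable_times)
qed

text \<open>The outer function \<open>h\<close> covers both uses: the identity for the plain
  estimator and the cut-off to \<Lambda> for the truncated one.\<close>

lemma observable_moment_estimator:
  fixes G h :: "real ^ 'p \<Rightarrow> real ^ 'p"
    and Y :: "real ^ 'p \<Rightarrow> real \<Rightarrow> real \<Rightarrow> 'a \<Rightarrow> real ^ 'r"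
  assumes G [measurable]: "G \<in> borel_measurable borel" and h [measurable]: "h \<in> borel_measurable borel"
    and pos: "\<And>\<epsilon>. 0 < \<epsilon> \<Longrightarrow> 0 < \<Delta> \<epsilon>"
  shows "observable_estimator \<Theta> M Y (\<lambda>\<theta> \<epsilon> \<omega>. h (moment_estimator Y \<Psi> G N \<Delta> \<theta> \<epsilon> \<omega>))"
  unfolding observable_estimator_def
proof (intro allI impI)
  fix \<epsilon> :: real assume "0 < \<epsilon>"
  then have d: "0 < \<Delta> \<epsilon>" by (rule pos)
  \<comment> \<open>The sum of all shifts dominates each of them, so one list of grid times serves
    every moment; \<open>Suc\<close> accounts for numbering the times from 0.\<close>
  define q where "q = Suc (N \<epsilon> + (\<Sum>j\<in>UNIV. moment_shift (\<Delta> \<epsilon>) (\<Psi> j)))"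
  \<comment> \<open>This extends a finite list of observations to a function of time, so that the
    same empirical functionals apply to it. Only its values at grid times matter, and
    \<open>g\<close> built from it does not involve \<theta>.\<close>
  define path where "path v s = (v (lag_steps (\<Delta> \<epsilon>) s) :: real ^ 'r)" for v s
  define g where "g v = h (G (\<chi> j. emp_moment (N \<epsilon>) (\<Delta> \<epsilon>) (path v) (\<Psi> j)))" for v
  have q: "n < q" if "n \<le> N \<epsilon> + moment_shift (\<Delta> \<epsilon>) (\<Psi> j)" for n j
    using that member_le_sum[of j UNIV "\<lambda>j. moment_shift (\<Delta> \<epsilon>) (\<Psi> j)"] by (simp add: q_def)
  have "(\<lambda>v. emp_moment (N \<epsilon>) (\<Delta> \<epsilon>) (path v) (\<Psi> j)) \<in> borel_measurable (PiM {..<q} (\<lambda>_. borel))" for j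
    by (rule emp_moment_measurable)
      (auto simp: path_def lag_steps_multiple d q intro!: measurable_component_singleton)
  then have [measurable]: "(\<lambda>v. \<chi> j. emp_moment (N \<epsilon>) (\<Delta> \<epsilon>) (path v) (\<Psi> j)) \<in>
      borel_measurable (PiM {..<q} (\<lambda>_. borel))"
    by (rule borel_measurable_vec_lambda)
  have g_meas: "g \<in> borel_measurable (PiM {..<q} (\<lambda>_. borel))" unfolding g_def by measurable
  have g_eq: "h (moment_estimator Y \<Psi> G N \<Delta> \<theta> \<epsilon> \<omega>) = g (\<lambda>i\<in>{..<q}. Y \<theta> \<epsilon> (real i * \<Delta> \<epsilon>) \<omega>)" for \<theta> \<omega>
  proof -
    have "emp_moment (N \<epsilon>) (\<Delta> \<epsilon>) (\<lambda>t. Y \<theta> \<epsilon> t \<omega>) (\<Psi> j) =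
        emp_moment (N \<epsilon>) (\<Delta> \<epsilon>) (path (\<lambda>i\<in>{..<q}. Y \<theta> \<epsilon> (real i * \<Delta> \<epsilon>) \<omega>)) (\<Psi> j)" for j
      by (rule emp_moment_cong) (simp add: path_def lag_steps_multiple d q)
    then show ?thesis by (simp add: moment_estimator_def g_def)
  qed
  have times: "\<forall>i<q. 0 \<le> real i * \<Delta> \<epsilon>" using d by simp
  show "\<exists>(q::nat) t g. (\<forall>i<q. 0 \<le> t i) \<and> g \<in> borel_measurable (PiM {..<q} (\<lambda>_. borel)) \<and>
      (\<forall>\<theta>\<in>\<Theta>. \<forall>\<omega>\<in>space (M \<theta>). h (moment_estimator Y \<Psi> G N \<Delta> \<theta> \<epsilon> \<omega>) =
        g (\<lambda>i\<in>{..<q}. Y \<theta> \<epsilon> (t i) \<omega>))"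
    by (intro exI[of _ q] exI[of _ "\<lambda>i. real i * \<Delta> \<epsilon>"] exI[of _ g] conjI ballI times g_meas g_eq)
qed

section \<open>Assembly over all parameters\<close>

lemma smooth_continuous_on: "smooth G \<Longrightarrow> continuous_on UNIV G"
  unfolding smooth_def by (drule spec[of _ 0]) simp

lemma smooth_differentiable: "smooth G \<Longrightarrow> G differentiable (at x)"
  unfolding smooth_def by (drule spec[of _ "Suc 0"]) simp

context subsampled_process
begin

definition emp_moments where
  "emp_moments \<Psi> \<epsilon> \<omega> = (\<chi> j. emp_moment (N \<epsilon>) (\<Delta> \<epsilon>) (\<lambda>t. Y \<epsilon> t \<omega>) (\<Psi> j))"

lemma emp_moments_measurable: "0 < \<epsilon> \<Longrightarrow> emp_moments \<Psi> \<epsilon> \<in> borel_measurable M"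
  unfolding emp_moments_def
  by (intro borel_measurable_vec_lambda emp_moment_measurable Y_measurable)
    (auto simp: scheme_pos less_imp_le)

lemma emp_moments_truncated_L2_order:
  assumes "\<And>j. valid_lag (\<Psi> j)"
  shows "truncated_L2_order M \<rho> (\<lambda>\<epsilon> \<omega>. norm (emp_moments \<Psi> \<epsilon> \<omega> - (\<chi> j. moment_value M X (\<Psi> j))))"
proof (rule truncated_L2_order_norm)
  show "truncated_L2_order M \<rho> (\<lambda>\<epsilon> \<omega>. (emp_moments \<Psi> \<epsilon> \<omega> - (\<chi> j. moment_value M X (\<Psi> j))) $ j)" for j
    using emp_moment_truncated_L2_order[OF assms, of j] by (simp add: emp_moments_def)
  show "(\<lambda>\<omega>. emp_moments \<Psi> \<epsilon> \<omega> - (\<chi> j. moment_value M X (\<Psi> j))) \<in> borel_measurable M" if "0 < \<epsilon>" for \<epsilon>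
    by (intro borel_measurable_diff emp_moments_measurable that borel_measurable_const)
qed

end

theorem theorem2:
  fixes \<Theta> :: "(real ^ 'p) set"
    and M :: "real ^ 'p \<Rightarrow> 'a measure"
    and X :: "real ^ 'p \<Rightarrow> real \<Rightarrow> 'a \<Rightarrow> real ^ 'r"
    and Y :: "real ^ 'p \<Rightarrow> real \<Rightarrow> real \<Rightarrow> 'a \<Rightarrow> real ^ 'r"
    and \<rho> :: "real \<Rightarrow> real"
    and f :: "real ^ 'p \<Rightarrow> real \<Rightarrow> real"
    and \<Psi> :: "'p \<Rightarrow> 'r lagged_moment"
    and G :: "real ^ 'p \<Rightarrow> real ^ 'p"
  assumes "indirect_observability \<Theta> M X Y \<rho>"
    and "\<And>\<theta>. \<theta> \<in> \<Theta> \<Longrightarrow> integrable_decorrelation_rate (M \<theta>) (X \<theta>) (f \<theta>)"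
    and "sparse_parametrization \<Theta> M X \<Psi> G"
  shows "(\<exists>est. observable_estimator \<Theta> M Y est \<and> consistent \<Theta> M est) \<and>
    (\<forall>N \<Delta>. subsampling_scheme \<rho> N \<Delta> \<longrightarrow>
      (let est = moment_estimator Y \<Psi> G N \<Delta> in
        observable_estimator \<Theta> M Y est \<and> consistent \<Theta> M est \<and>
        (\<forall>\<Lambda> c R. (\<Lambda> = ball c R \<or> \<Lambda> = cball c R) \<and> \<Theta> \<subseteq> \<Lambda> \<longrightarrow>
          observable_estimator \<Theta> M Y (truncated \<Lambda> est) \<and>
          (\<forall>\<theta>\<in>\<Theta>.
            ((\<lambda>\<epsilon>. Lp_norm (M \<theta>) 2 (\<lambda>\<omega>. truncated \<Lambda> est \<theta> \<epsilon> \<omega> - \<theta>)) \<longlongrightarrow> 0) (at_right 0) \<and>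
            (\<exists>C. \<forall>\<^sub>F \<epsilon> in at_right 0.
              Lp_norm_le (M \<theta>) 2 (\<lambda>\<omega>. truncated \<Lambda> est \<theta> \<epsilon> \<omega> - \<theta>) (C * \<rho> \<epsilon>))))))"
proof -
  interpret indirect_observability \<Theta> M X Y \<rho> by (rule assms(1))
  have valid: "\<And>j. valid_lag (\<Psi> j)" and "smooth G"
    and \<theta>_eq: "\<And>\<theta>. \<theta> \<in> \<Theta> \<Longrightarrow> G (\<chi> j. moment_value (M \<theta>) (X \<theta>) (\<Psi> j)) = \<theta>"
    using assms(3) by (auto simp: sparse_parametrization_def)
  then have G: "continuous_on UNIV G" "\<And>x. G differentiable (at x)" by (auto intro: smooth_continuous_on smooth_differentiable)
  then have G_meas: "G \<in> borel_measurable borel" by (intro borel_measurable_continuous_onI)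
  have main: "observable_estimator \<Theta> M Y (moment_estimator Y \<Psi> G N \<Delta>)" (is ?obs)
      "consistent \<Theta> M (moment_estimator Y \<Psi> G N \<Delta>)" (is ?cons)
      "\<forall>\<Lambda> c R. (\<Lambda> = ball c R \<or> \<Lambda> = cball c R) \<and> \<Theta> \<subseteq> \<Lambda> \<longrightarrow>
        observable_estimator \<Theta> M Y (truncated \<Lambda> (moment_estimator Y \<Psi> G N \<Delta>)) \<and>
        (\<forall>\<theta>\<in>\<Theta>. ((\<lambda>\<epsilon>. Lp_norm (M \<theta>) 2 (\<lambda>\<omega>. truncated \<Lambda> (moment_estimator Y \<Psi> G N \<Delta>) \<theta> \<epsilon> \<omega> - \<theta>))
            \<longlongrightarrow> 0) (at_right 0) \<and>
          (\<exists>C. \<forall>\<^sub>F \<epsilon> in at_right 0.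
            Lp_norm_le (M \<theta>) 2 (\<lambda>\<omega>. truncated \<Lambda> (moment_estimator Y \<Psi> G N \<Delta>) \<theta> \<epsilon> \<omega> - \<theta>) (C * \<rho> \<epsilon>)))"
      (is ?trunc)
    if scheme: "subsampling_scheme \<rho> N \<Delta>" for N \<Delta>
  proof -
    have pos: "\<And>\<epsilon>. 0 < \<epsilon> \<Longrightarrow> 0 < \<Delta> \<epsilon>" using scheme by (simp add: subsampling_scheme_def)
    show ?obs
      using observable_moment_estimator[where h = "\<lambda>x. x", OF G_meas _ pos] by simp
    have process: "subsampled_process (M \<theta>) (X \<theta>) (Y \<theta>) \<rho> (f \<theta>) N \<Delta>" if \<theta>: "\<theta> \<in> \<Theta>" for \<theta>
    proof -
      have "\<exists>\<delta>>0. \<exists>L. L-lipschitz_on (cball u \<delta> \<inter> {0..}) (lagged_cov (M \<theta>) (X \<theta>))" if "0 \<le> u" for u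
        using cov_Lipschitz[OF that] \<theta> by blast
      then show ?thesis
        by (intro subsampled_process.intro subsampled_process_axioms.intro prob_space_M Y_measurable
            Y_bounded X_stationary rho_pos rho_tendsto Y_approx assms(2) scheme \<theta>)
    qed
    have est: "moment_estimator Y \<Psi> G N \<Delta> \<theta> \<epsilon> \<omega> = G (subsampled_process.emp_moments (Y \<theta>) N \<Delta> \<Psi> \<epsilon> \<omega>)"
      if "\<theta> \<in> \<Theta>" for \<theta> \<epsilon> \<omega>
      by (simp add: moment_estimator_def subsampled_process.emp_moments_def[OF process[OF that]])
    show ?cons
      unfolding consistent_def
    proof (intro ballI allI impI)
      fix \<theta> and \<delta> :: real assume \<theta>: "\<theta> \<in> \<Theta>" and \<delta>: "0 < \<delta>"
      interpret subsampled_process "M \<theta>" "X \<theta>" "Y \<theta>" \<rho> "f \<theta>" N \<Delta> by (rule process[OF \<theta>])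
      have "isCont G (\<chi> j. moment_value (M \<theta>) (X \<theta>) (\<Psi> j))"
        using G(1) by (simp add: continuous_on_eq_continuous_at)
      then show "((\<lambda>\<epsilon>. measure (M \<theta>) {\<omega> \<in> space (M \<theta>).
          \<delta> < infnorm (moment_estimator Y \<Psi> G N \<Delta> \<theta> \<epsilon> \<omega> - \<theta>)}) \<longlongrightarrow> 0) (at_right 0)"
        using plug_in_consistent[OF emp_moments_measurable
            emp_moments_truncated_L2_order[of \<Psi>, OF valid] G_meas _ rho_tendsto \<delta>]
        by (simp add: est[OF \<theta>] \<theta>_eq[OF \<theta>])
    qed
    show ?trunc
    proof (intro allI impI conjI ballI)
      fix \<Lambda> c R assume \<Lambda>: "(\<Lambda> = ball c R \<or> \<Lambda> = cball c R) \<and> \<Theta> \<subseteq> \<Lambda>"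
      then have \<Lambda>_meas [measurable]: "\<Lambda> \<in> sets borel" and bounded: "bounded \<Lambda>" by auto
      show "observable_estimator \<Theta> M Y (truncated \<Lambda> (moment_estimator Y \<Psi> G N \<Delta>))"
        using observable_moment_estimator[where h = "\<lambda>x. indicator \<Lambda> x *\<^sub>R x", OF G_meas _ pos]
        by (simp add: truncated_def[abs_def])
      fix \<theta> assume \<theta>: "\<theta> \<in> \<Theta>"
      interpret subsampled_process "M \<theta>" "X \<theta>" "Y \<theta>" \<rho> "f \<theta>" N \<Delta> by (rule process[OF \<theta>])
      \<comment> \<open>An open set contained in \<Lambda> lies in its interior, so open and closed
        balls need no separate treatment.\<close>
      have "\<theta> \<in> interior \<Lambda>" using interior_maximal[OF _ open_params] \<Lambda> \<theta> by blast
      then show *: "\<exists>C. \<forall>\<^sub>F \<epsilon> in at_right 0.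
          Lp_norm_le (M \<theta>) 2 (\<lambda>\<omega>. truncated \<Lambda> (moment_estimator Y \<Psi> G N \<Delta>) \<theta> \<epsilon> \<omega> - \<theta>) (C * \<rho> \<epsilon>)"
        using plug_in_truncated_rate[OF emp_moments_measurable
            emp_moments_truncated_L2_order[of \<Psi>, OF valid] G_meas G(2) rho_pos \<Lambda>_meas bounded]
        by (simp add: truncated_def est[OF \<theta>] \<theta>_eq[OF \<theta>])
      \<comment> \<open>The L^2 convergence follows from the rate, since the norm is squeezed
        between 0 and C \<rho>.\<close>
      then obtain C where C: "\<forall>\<^sub>F \<epsilon> in at_right 0.
          Lp_norm (M \<theta>) 2 (\<lambda>\<omega>. truncated \<Lambda> (moment_estimator Y \<Psi> G N \<Delta>) \<theta> \<epsilon> \<omega> - \<theta>) \<le> C * \<rho> \<epsilon>"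
        unfolding Lp_norm_le_def by (auto dest: eventually_conj_iff[THEN iffD1])
      show "((\<lambda>\<epsilon>. Lp_norm (M \<theta>) 2 (\<lambda>\<omega>. truncated \<Lambda> (moment_estimator Y \<Psi> G N \<Delta>) \<theta> \<epsilon> \<omega> - \<theta>))
          \<longlongrightarrow> 0) (at_right 0)"
      proof (rule tendsto_sandwich[OF _ C tendsto_const])
        show "((\<lambda>\<epsilon>. C * \<rho> \<epsilon>) \<longlongrightarrow> 0) (at_right 0)"
          using tendsto_mult[OF tendsto_const rho_tendsto, of C] by simp
      qed (simp add: Lp_norm_def)
    qed
  qed
  \<comment> \<open>The unconditional existence claim is the scheme-dependent claim applied to one
    explicit scheme.\<close>
  obtain N \<Delta> where "subsampling_scheme \<rho> N \<Delta>"
    using subsampling_scheme_exists[OF rho_pos rho_tendsto] .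
  then have "\<exists>est. observable_estimator \<Theta> M Y est \<and> consistent \<Theta> M est" using main(1,2) by blast
  then show ?thesis unfolding Let_def using main by blast
qed

end
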